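(* Let $\mathcal{X}$ be a separable complete metric space, and let $\Lambda_{\mathsf{dF}}$, $\Lambda_{\mathsf{01}}$, $\Lambda_{\mathsf{LLN}}\subseteq\Lambda^\infty$ be the sets of weight sequences satisfying, respectively, the weighted de Finetti property, the weighted zero-one law, and the weighted law of large numbers (all defined in the context). Then $$\Lambda_{\mathsf{dF}}\subseteq\Lambda_{\mathsf{01}}\subseteq\Lambda_{\mathsf{LLN}}.$$
   Context: $\mathcal{X}$ is a separable complete metric space with Borel $\sigma$-algebra $\mathcal{B}(\mathcal{X})$; $\mathcal{X}^n$ and $\mathcal{X}^\infty$ are the finite and countably infinite products with Borel $\sigma$-algebras $\mathcal{B}(\mathcal{X}^n)$, $\mathcal{B}(\mathcal{X}^\infty)$. $\Lambda$ is the set of measurable functions $\mathcal{X}\to(0,\infty)$; $\Lambda^n$ and $\Lambda^\infty$ are the sets of finite/infinite sequences of such functions. $\mathcal{M}_{\mathcal{X}}$ is the set of all (not necessarily finite) measures on $\mathcal{X}$, with the $\sigma$-algebra generated by the sets $\{P: P(A)\le t\}$, $A\in\mathcal{B}(\mathcal{X})$, $t\ge 0$. "Distribution" means probability measure. $\mathcal{S}_n$ is the set of permutations of $[n]=\{1,\dots,n\}$. Weighted exchangeability. A measure $R$ on $\mathcal{X}^n$ is exchangeable if $R(A_1\times\dots\times A_n)=R(A_{\sigma(1)}\times\dots\times A_{\sigma(n)})$ for all $A_1,\dots,A_n\in\mathcal{B}(\mathcal{X})$ and $\sigma\in\mathcal{S}_n$. For $\lambda\in\Lambda^n$, a measure $Q$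 on $\mathcal{X}^n$ is $\lambda$-weighted exchangeable if the measure $\overline{Q}(A)=\int_A \frac{dQ(x_1,\dots,x_n)}{\lambda_1(x_1)\cdots\lambda_n(x_n)}$, $A\in\mathcal{B}(\mathcal{X}^n)$, is exchangeable. For $\lambda\in\Lambda^\infty$, a measure $Q$ on $\mathcal{X}^\infty$ is $\lambda$-weighted exchangeable if for every $n\ge1$ its marginal $Q_n$ on the first $n$ coordinates is $(\lambda_1,\dots,\lambda_n)$-weighted exchangeable. Reweighting. For $\lambda\in\Lambda^\infty$, $\mathcal{M}_{\mathcal{X}}(\lambda)=\{P\in\mathcal{M}_{\mathcal{X}}: 0<\int_{\mathcal{X}}\lambda_i\,dP<\infty \text{ for all } i\}$. For $P\in\mathcal{M}_{\mathcal{X}}(\lambda)$, $P\circ\lambda_i$ is the distribution $(P\circ\lambda_i)(A)=\int_A\lambda_i\,dP\big/\int_{\mathcal{X}}\lambda_i\,dP$ on $\mathcal{X}$, and $P\circ\lambda=(P\circ\lambda_1)\times(P\circ\lambda_2)\times\cdots$ is the product distribution on $\mathcal{X}^\infty$. For a distribution $\mu$ on $\mathcal{M}_{\mathcal{X}}(\lambda)$, $(P\circ\lambda)_\mu$ is the distribution $A\mapsto\mathbb{E}_{P\sim\mu}[(P\circ\lambda)(A)]$ on $\mathcal{X}^\infty$. Exchangeable $\sigma$-algebra: $\mathcal{E}_\infty$ is the set of $A\in\mathcal{B}(\mathcal{X}^\infty)$ such that for all $x\in A$, $n\ge1$, $\sigma\in\mathcal{S}_n$, one has $(x_{\sigma(1)},\dots,x_{\sigma(n)},x_{n+1},x_{n+2},\dots)\in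 A$. The three sets: - $\Lambda_{\mathsf{dF}}$: all $\lambda\in\Lambda^\infty$ such that for every $\lambda$-weighted exchangeable distribution $Q$ on $\mathcal{X}^\infty$ there is a distribution $\mu$ on $\mathcal{M}_{\mathcal{X}}(\lambda)$ with $Q=(P\circ\lambda)_\mu$. - $\Lambda_{\mathsf{01}}$: all $\lambda\in\Lambda^\infty$ such that $(P\circ\lambda)(A)\in\{0,1\}$ for all $P\in\mathcal{M}_{\mathcal{X}}(\lambda)$ and $A\in\mathcal{E}_\infty$. - $\Lambda_{\mathsf{LLN}}$: all $\lambda\in\Lambda^\infty$ such that for all $P\in\mathcal{M}_{\mathcal{X}}(\lambda)$, $i\ge1$, $A\in\mathcal{B}(\mathcal{X})$, if $X\sim P\circ\lambda$ then $\widetilde{P}_{n,i}(A)\to(P\circ\lambda_i)(A)$ almost surely as $n\to\infty$, where for $n\ge i$ $$\widetilde{P}_{n,i}=\sum_{j=1}^n (w_{n,i}(X_1,\dots,X_n))_j\,\delta_{X_j},\qquad (w_{n,i}(x_1,\dots,x_n))_j=\frac{\sum_{\sigma\in\mathcal{S}_n:\sigma(i)=j}\prod_{k=1}^n\lambda_k(x_{\sigma(k)})}{\sum_{\sigma\in\mathcal{S}_n}\prod_{k=1}^n\lambda_k(x_{\sigma(k)})}.$$ *)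

theory Defs
  imports "HOL-Probability.Probability"
begin

text \<open>
  Coordinates are indexed from 0, so index \<open>i\<close> here is index \<open>i + 1\<close> in the usual notation, and
  \<open>{1..n}\<close> becomes \<open>{..<n}\<close>. The underlying space \<open>\<X>\<close> is a type, of class \<open>polish_space\<close> in
  the final statement.
\<close>

subsection \<open>Product spaces and spaces of measures\<close>

text \<open>
  For a second countable space the product sigma-algebras below are the Borel sigma-algebras of the
  product topologies (for the infinite product, see \<open>sets_seq_space\<close>).
\<close>

abbreviation fin_space :: "nat \<Rightarrow> (nat \<Rightarrow> 'a::topological_space) measure" where
  "fin_space n \<equiv> PiM {..<n} (\<lambda>_. borel)"

abbreviation seq_space :: "(nat \<Rightarrow> 'a::topological_space) measure" where
  "seq_space \<equiv> PiM UNIV (\<lambda>_. borel)"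

lemma sets_seq_space:
  "sets (seq_space :: (nat \<Rightarrow> 'a::second_countable_topology) measure) = sets borel"
  by (rule sets_PiM_equal_borel)

definition weight_seqs :: "(nat \<Rightarrow> 'a::topological_space \<Rightarrow> real) set" where
  "weight_seqs = {l. \<forall>i. l i \<in> borel_measurable borel \<and> (\<forall>x. 0 < l i x)}"

text \<open>Arbitrary Borel measures, with no finiteness assumption.\<close>

definition borel_measures :: "'a::topological_space measure set" where
  "borel_measures = {P. sets P = sets borel}"

definition borel_measures_algebra :: "'a::topological_space measure measure" where
  "borel_measures_algebra = sigma borel_measures
     {{P \<in> borel_measures. emeasure P A \<le> ennreal t} | A t. A \<in> sets borel \<and> 0 \<le> t}"

subsection \<open>Weighted exchangeability\<close>

definition exchangeable :: "nat \<Rightarrow> (nat \<Rightarrow> 'a::topological_space) measure \<Rightarrow> bool" where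
  "exchangeable n R \<longleftrightarrow> sets R = sets (fin_space n) \<and>
     (\<forall>A s. (\<forall>i<n. A i \<in> sets borel) \<longrightarrow> s permutes {..<n} \<longrightarrow>
        emeasure R (PiE {..<n} A) = emeasure R (PiE {..<n} (\<lambda>i. A (s i))))"

definition weighted_exchangeable_fin ::
    "nat \<Rightarrow> (nat \<Rightarrow> 'a::topological_space \<Rightarrow> real) \<Rightarrow> (nat \<Rightarrow> 'a) measure \<Rightarrow> bool" where
  "weighted_exchangeable_fin n l Q \<longleftrightarrow> sets Q = sets (fin_space n) \<and>
     exchangeable n (density Q (\<lambda>x. ennreal (1 / (\<Prod>i<n. l i (x i)))))"

definition marginal :: "nat \<Rightarrow> (nat \<Rightarrow> 'a::topological_space) measure \<Rightarrow> (nat \<Rightarrow> 'a) measure" where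
  "marginal n Q = distr Q (fin_space n) (\<lambda>x. restrict x {..<n})"

definition weighted_exchangeable ::
    "(nat \<Rightarrow> 'a::topological_space \<Rightarrow> real) \<Rightarrow> (nat \<Rightarrow> 'a) measure \<Rightarrow> bool" where
  "weighted_exchangeable l Q \<longleftrightarrow> sets Q = sets seq_space \<and>
     (\<forall>n\<ge>1. weighted_exchangeable_fin n l (marginal n Q))"

subsection \<open>Reweighting\<close>

definition reweightable_measures ::
    "(nat \<Rightarrow> 'a::topological_space \<Rightarrow> real) \<Rightarrow> 'a measure set" where
  "reweightable_measures l = {P \<in> borel_measures.
     \<forall>i. 0 < (\<integral>\<^sup>+x. ennreal (l i x) \<partial>P) \<and> (\<integral>\<^sup>+x. ennreal (l i x) \<partial>P) < \<infinity>}"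

definition reweight :: "'a measure \<Rightarrow> ('a \<Rightarrow> real) \<Rightarrow> 'a measure" where
  "reweight P f = scale_measure (1 / (\<integral>\<^sup>+x. ennreal (f x) \<partial>P)) (density P (\<lambda>x. ennreal (f x)))"

lemma emeasure_reweight:
  assumes "P \<in> borel_measures" "f \<in> borel_measurable borel" "A \<in> sets borel"
  shows "emeasure (reweight P f) A =
    (\<integral>\<^sup>+x\<in>A. ennreal (f x) \<partial>P) / (\<integral>\<^sup>+x. ennreal (f x) \<partial>P)"
proof -
  have P: "sets P = sets borel"
    using assms(1) by (simp add: borel_measures_def)
  have f: "(\<lambda>x. ennreal (f x)) \<in> borel_measurable P"
    unfolding measurable_cong_sets[OF P refl]
    using assms(2) by (rule measurable_compose[OF _ measurable_ennreal])
  have "A \<in> sets P"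
    using P assms(3) by simp
  then show ?thesis
    by (simp only: reweight_def emeasure_scale_measure emeasure_density[OF f] ennreal_divide_times)
       simp
qed

lemma prob_space_reweight:
  assumes "l \<in> weight_seqs" "P \<in> reweightable_measures l"
  shows "prob_space (reweight P (l i))"
proof (rule prob_spaceI)
  have P: "P \<in> borel_measures"
    and Z: "0 < (\<integral>\<^sup>+x. ennreal (l i x) \<partial>P)" "(\<integral>\<^sup>+x. ennreal (l i x) \<partial>P) < \<infinity>"
    using assms(2) unfolding reweightable_measures_def by blast+
  have "space P = UNIV"
    using P sets_eq_imp_space_eq[of P borel] by (simp add: borel_measures_def)
  then have "space (reweight P (l i)) = UNIV"
    by (simp add: reweight_def space_scale_measure)
  moreover have "emeasure (reweight P (l i)) UNIV = 1"
  proof -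
    have "l i \<in> borel_measurable borel"
      using assms(1) unfolding weight_seqs_def by blast
    then have "emeasure (reweight P (l i)) UNIV =
        (\<integral>\<^sup>+x. ennreal (l i x) \<partial>P) / (\<integral>\<^sup>+x. ennreal (l i x) \<partial>P)"
      using emeasure_reweight[OF P, of "l i" UNIV] by simp
    also have "\<dots> = 1"
      using Z by (intro ennreal_divide_self) auto
    finally show ?thesis .
  qed
  ultimately show "emeasure (reweight P (l i)) (space (reweight P (l i))) = 1"
    by simp
qed

definition reweight_seq ::
    "'a measure \<Rightarrow> (nat \<Rightarrow> 'a \<Rightarrow> real) \<Rightarrow> (nat \<Rightarrow> 'a) measure" where
  "reweight_seq P l = PiM UNIV (\<lambda>i. reweight P (l i))"

text \<open>
  A distribution on \<open>reweightable_measures l\<close> is a probability measure on the trace sigma-algebra.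
\<close>

definition mixing_distribution ::
    "(nat \<Rightarrow> 'a::topological_space \<Rightarrow> real) \<Rightarrow> 'a measure measure \<Rightarrow> bool" where
  "mixing_distribution l \<mu> \<longleftrightarrow> prob_space \<mu> \<and>
     sets \<mu> = sets (restrict_space borel_measures_algebra (reweightable_measures l))"

definition mixture ::
    "(nat \<Rightarrow> 'a::topological_space \<Rightarrow> real) \<Rightarrow> 'a measure measure \<Rightarrow> (nat \<Rightarrow> 'a) measure" where
  "mixture l \<mu> = measure_of UNIV (sets seq_space)
     (\<lambda>A. \<integral>\<^sup>+P. emeasure (reweight_seq P l) A \<partial>\<mu>)"

subsection \<open>The three properties of weight sequences\<close>

definition weights_dF :: "(nat \<Rightarrow> 'a::topological_space \<Rightarrow> real) set" where
  "weights_dF = {l \<in> weight_seqs. \<forall>Q. prob_space Q \<and> weighted_exchangeable l Q \<longrightarrow>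
     (\<exists>\<mu>. mixing_distribution l \<mu> \<and> Q = mixture l \<mu>)}"

definition exchangeable_algebra :: "(nat \<Rightarrow> 'a::topological_space) set set" where
  "exchangeable_algebra = {A \<in> sets seq_space.
     \<forall>x\<in>A. \<forall>n\<ge>1. \<forall>s. s permutes {..<n} \<longrightarrow> (\<lambda>i. x (s i)) \<in> A}"

definition weights_01 :: "(nat \<Rightarrow> 'a::topological_space \<Rightarrow> real) set" where
  "weights_01 = {l \<in> weight_seqs. \<forall>P \<in> reweightable_measures l. \<forall>A \<in> exchangeable_algebra.
     emeasure (reweight_seq P l) A \<in> {0, 1}}"

definition perm_weight ::
    "(nat \<Rightarrow> 'a \<Rightarrow> real) \<Rightarrow> nat \<Rightarrow> nat \<Rightarrow> (nat \<Rightarrow> 'a) \<Rightarrow> nat \<Rightarrow> real" where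
  "perm_weight l n i x j =
     (\<Sum>s | s permutes {..<n} \<and> s i = j. \<Prod>k<n. l k (x (s k))) /
     (\<Sum>s | s permutes {..<n}. \<Prod>k<n. l k (x (s k)))"

text \<open>
  The mass that the weighted empirical measure gives to \<open>A\<close>; \<open>return borel y\<close> is the point mass
  at \<open>y\<close>. It is meaningful for \<open>i < n\<close>; the finitely many other \<open>n\<close> are irrelevant to limits.
\<close>

definition weighted_empirical ::
    "(nat \<Rightarrow> 'a::topological_space \<Rightarrow> real) \<Rightarrow> nat \<Rightarrow> nat \<Rightarrow> (nat \<Rightarrow> 'a) \<Rightarrow> 'a set \<Rightarrow> real" where
  "weighted_empirical l n i x A =
     (\<Sum>j<n. perm_weight l n i x j * measure (return borel (x j)) A)"

definition weights_LLN :: "(nat \<Rightarrow> 'a::topological_space \<Rightarrow> real) set" where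
  "weights_LLN = {l \<in> weight_seqs. \<forall>P \<in> reweightable_measures l. \<forall>i. \<forall>A \<in> sets borel.
     AE x in reweight_seq P l.
       (\<lambda>n. weighted_empirical l n i x A) \<longlonglongrightarrow> measure (reweight P (l i)) A}"

end

theory Submission
  imports Defs
begin

text \<open>
  Write \<open>R = reweight_seq P l\<close> for the product law. Both inclusions rest on one invariance
  (\<open>nn_integral_reweight_seq_permute\<close>): \<open>R\<close> divided by the product of the first \<open>n\<close> weights is invariant
  under permutations of the first \<open>n\<close> coordinates.

  \<^emph>\<open>De Finetti implies zero-one.\<close> If an exchangeable event \<open>A\<close> had probability strictly between
  0 and 1 under \<open>R\<close>, then the conditional laws of \<open>R\<close> given \<open>A\<close> and given its complement would both be
  weighted exchangeable (\<open>weighted_exchangeable_uniform\<close>), hence mixtures of product laws. Combining the two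
  mixing measures exhibits the product law \<open>R\<close> itself as such a mixture. Comparing pairs of
  coordinates shows that the mixing measure is concentrated on components with the same product law as
  \<open>P\<close> (\<open>AE_mixing_constant\<close>, the equality case of Jensen's inequality followed by a variance computation).
  So the conditional law given \<open>A\<close> equals \<open>R\<close>, and \<open>A\<close> has probability 1, a contradiction.

  \<^emph>\<open>Zero-one implies the law of large numbers.\<close> Averaging the invariance over all permutations shows
  that the weighted empirical mass of \<open>A\<close> is the conditional probability of \<open>x i \<in> A\<close> given the events
  that are symmetric in the first \<open>n\<close> coordinates (\<open>nn_integral_weighted_empirical\<close>). These masses
  thus form a reversed martingale. The zero-one law makes the event that they exceed \<open>c\<close> infinitely often
  trivial, and the maximal inequality \<open>reverse_martingale_maximal\<close> rules out that it is almost sure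
  when \<open>c\<close> exceeds the probability of \<open>x i \<in> A\<close>. This bounds the upper limit; the complement of \<open>A\<close>
  gives the lower limit, without a general convergence theorem for reversed martingales.
\<close>

section \<open>Infinite products of probability measures\<close>

lemma prod_emb_UNIV_PiE:
  assumes "\<And>i. space (M i) = UNIV"
  shows "prod_emb UNIV M J (PiE J A) = {x. \<forall>i\<in>J. x i \<in> A i}"
  using assms by (auto simp: prod_emb_def space_PiM PiE_iff)

lemma nn_integral_PiM_prod:
  fixes M :: "'i \<Rightarrow> 'a measure"
  assumes M: "\<And>i. i \<in> I \<Longrightarrow> prob_space (M i)" and L: "finite L" "L \<subseteq> I"
    and h: "\<And>i. i \<in> L \<Longrightarrow> h i \<in> borel_measurable (M i)"
  shows "(\<integral>\<^sup>+x. (\<Prod>i\<in>L. h i (x i)) \<partial>PiM I M) = (\<Prod>i\<in>L. \<integral>\<^sup>+y. h i y \<partial>M i)"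
proof -
  let ?M = "\<lambda>i. if i \<in> I then M i else count_space {undefined}"
  interpret M': prob_space "?M i" for i
    using M by (cases "i \<in> I") (auto intro!: prob_spaceI)
  interpret product_prob_space ?M I
    by unfold_locales
  have h': "h i \<in> borel_measurable (?M i)" if "i \<in> L" for i
    using h[OF that] L that by auto
  have "(\<integral>\<^sup>+x. (\<Prod>i\<in>L. h i (x i)) \<partial>PiM I M) = (\<integral>\<^sup>+x. (\<Prod>i\<in>L. h i (x i)) \<partial>PiM I ?M)"
    by (intro arg_cong2[where f=nn_integral] PiM_cong) auto
  also have "\<dots> = (\<integral>\<^sup>+x. (\<Prod>i\<in>L. h i (restrict x L i)) \<partial>PiM I ?M)"
    by (intro nn_integral_cong prod.cong) auto
  also have "\<dots> = (\<integral>\<^sup>+x. (\<Prod>i\<in>L. h i (x i)) \<partial>distr (PiM I ?M) (PiM L ?M) (\<lambda>x. restrict x L))"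
    using h' L
    by (subst nn_integral_distr)
       (auto intro!: measurable_restrict_subset borel_measurable_prod_ennreal
          measurable_compose[OF measurable_component_singleton])
  also have "\<dots> = (\<Prod>i\<in>L. \<integral>\<^sup>+y. h i y \<partial>?M i)"
    using h' L by (subst distr_PiM_restrict_finite) (auto intro!: product_nn_integral_prod)
  also have "\<dots> = (\<Prod>i\<in>L. \<integral>\<^sup>+y. h i y \<partial>M i)"
    using L by (intro prod.cong) auto
  finally show ?thesis .
qed

lemma PiM_density:
  fixes M :: "'i \<Rightarrow> 'a measure"
  assumes M: "\<And>i. prob_space (M i)" and N: "\<And>i. prob_space (density (M i) (g i))"
    and g[measurable]: "\<And>i. g i \<in> borel_measurable (M i)"
    and K: "finite K" and one: "\<And>i x. i \<notin> K \<Longrightarrow> g i x = 1"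
  shows "PiM UNIV (\<lambda>i. density (M i) (g i)) = density (PiM UNIV M) (\<lambda>x. \<Prod>i\<in>K. g i (x i))"
    (is "PiM UNIV ?N = ?D")
proof -
  interpret M: prob_space "M i" for i by (rule M)
  interpret N: prob_space "?N i" for i by (rule N)
  interpret N: product_prob_space ?N UNIV by unfold_locales
  have "?D = PiM UNIV ?N"
  proof (rule N.PiM_eq)
    have "sets (PiM UNIV M) = sets (PiM UNIV ?N)"
      by (rule sets_PiM_cong) auto
    then show "sets ?D = sets (PiM UNIV ?N)" by simp
    fix J A
    assume J: "finite J" "J \<subseteq> UNIV" and A: "\<And>j. j \<in> J \<Longrightarrow> A j \<in> sets (?N j)"
    have [measurable]: "A j \<in> sets (M j)" if "j \<in> J" for j
      using A[OF that] by simp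
    let ?R = "prod_emb UNIV ?N J (PiE J A)"
    have R: "?R = prod_emb UNIV M J (PiE J A)"
      by (simp add: prod_emb_def space_PiM)
    have RM: "?R \<in> sets (PiM UNIV M)"
      unfolding R using J by (intro sets_PiM_I) auto
    define h where "h i y = g i y * (if i \<in> J then indicator (A i) y else 1)" for i y
    have hm: "h i \<in> borel_measurable (M i)" for i
      unfolding h_def by (cases "i \<in> J") auto
    have "emeasure ?D ?R = (\<integral>\<^sup>+x. (\<Prod>i\<in>K. g i (x i)) * indicator ?R x \<partial>PiM UNIV M)"
      using RM K by (subst emeasure_density)
       (auto intro!: borel_measurable_prod_ennreal measurable_compose[OF measurable_component_singleton])
    also have "\<dots> = (\<integral>\<^sup>+x. (\<Prod>i\<in>K \<union> J. h i (x i)) \<partial>PiM UNIV M)"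
    proof (intro nn_integral_cong)
      fix x assume x: "x \<in> space (PiM UNIV M)"
      have "(\<Prod>i\<in>K \<union> J. h i (x i)) =
          (\<Prod>i\<in>K \<union> J. g i (x i)) * (\<Prod>i\<in>K \<union> J. if i \<in> J then indicator (A i) (x i) else 1)"
        by (simp add: h_def prod.distrib)
      also have "(\<Prod>i\<in>K \<union> J. g i (x i)) = (\<Prod>i\<in>K. g i (x i))"
        using K J one by (intro prod.mono_neutral_right) auto
      also have "(\<Prod>i\<in>K \<union> J. if i \<in> J then indicator (A i) (x i) else 1) =
          (\<Prod>i\<in>J. indicator (A i) (x i) :: ennreal)"
        using K J by (intro prod.mono_neutral_cong_right) auto
      also have "\<dots> = indicator ?R x"
        using x J unfolding R
        by (auto simp: prod_emb_def space_PiM PiE_iff indicator_def intro!: prod.neutral prod_zero)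
      finally show "(\<Prod>i\<in>K. g i (x i)) * indicator ?R x = (\<Prod>i\<in>K \<union> J. h i (x i))" by simp
    qed
    also have "\<dots> = (\<Prod>i\<in>K \<union> J. \<integral>\<^sup>+y. h i y \<partial>M i)"
      using K J hm M by (intro nn_integral_PiM_prod) auto
    also have "\<dots> = (\<Prod>i\<in>J. emeasure (?N i) (A i))"
    proof (rule prod.mono_neutral_cong_right)
      show "\<forall>i\<in>K \<union> J - J. (\<integral>\<^sup>+y. h i y \<partial>M i) = 1"
      proof
        fix i assume "i \<in> K \<union> J - J"
        then have "(\<integral>\<^sup>+y. h i y \<partial>M i) = (\<integral>\<^sup>+y. g i y * indicator (space (M i)) y \<partial>M i)"
          by (intro nn_integral_cong) (auto simp: h_def)
        also have "\<dots> = emeasure (?N i) (space (?N i))"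
          by (subst emeasure_density) auto
        finally show "(\<integral>\<^sup>+y. h i y \<partial>M i) = 1" by (simp only: prob_space.emeasure_space_1[OF N])
      qed
    qed (use K J in \<open>auto simp: h_def emeasure_density\<close>)
    finally show "emeasure ?D ?R = (\<Prod>i\<in>J. emeasure (?N i) (A i))" .
  qed
  then show ?thesis by simp
qed

section \<open>Reweighted measures\<close>

lemma sets_reweight [simp, measurable_cong]:
  "P \<in> reweightable_measures l \<Longrightarrow> sets (reweight P f) = sets borel"
  by (simp add: reweight_def reweightable_measures_def borel_measures_def)

lemma space_reweight [simp]:
  "P \<in> reweightable_measures l \<Longrightarrow> space (reweight P f) = UNIV"
  using sets_eq_imp_space_eq[OF sets_reweight, of P l f] by simp

lemma sets_reweight_seq [simp, measurable_cong]:
  "P \<in> reweightable_measures l \<Longrightarrow> sets (reweight_seq P l) = sets seq_space"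
  unfolding reweight_seq_def by (intro sets_PiM_cong) simp_all

lemma space_reweight_seq [simp]:
  "P \<in> reweightable_measures l \<Longrightarrow> space (reweight_seq P l) = UNIV"
  by (simp add: reweight_seq_def space_PiM)

lemma weight_seqsD:
  assumes "l \<in> weight_seqs"
  shows measurable_weight: "l i \<in> borel_measurable borel" and weight_pos: "0 < l i x"
  using assms by (auto simp: weight_seqs_def)

lemma prob_space_reweight_seq:
  "l \<in> weight_seqs \<Longrightarrow> P \<in> reweightable_measures l \<Longrightarrow> prob_space (reweight_seq P l)"
  unfolding reweight_seq_def by (intro prob_space_PiM prob_space_reweight)

lemma nn_integral_reweight:
  assumes P: "sets P = sets borel" and f: "f \<in> borel_measurable borel"
    and h: "h \<in> borel_measurable borel"
  shows "(\<integral>\<^sup>+x. h x \<partial>reweight P f) = (\<integral>\<^sup>+x. ennreal (f x) * h x \<partial>P) / (\<integral>\<^sup>+x. ennreal (f x) \<partial>P)"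
proof -
  note [measurable_cong] = P and [measurable] = f h
  show ?thesis
    by (simp add: reweight_def nn_integral_scale_measure nn_integral_density
        ennreal_divide_times ennreal_times_divide mult.commute)
qed

lemma rectangle_in_sets:
  assumes "finite J" "\<And>i. i \<in> J \<Longrightarrow> B i \<in> sets borel"
  shows "{x. \<forall>i\<in>J. x i \<in> B i} \<in> sets (seq_space :: (nat \<Rightarrow> 'a::topological_space) measure)"
proof -
  have "{x \<in> space seq_space. \<forall>i\<in>J. x i \<in> B i} \<in> sets (seq_space :: (nat \<Rightarrow> 'a) measure)"
    using assms by (intro sets.sets_Collect_finite_All) auto
  then show ?thesis by (simp add: space_PiM)
qed

lemma emeasure_reweight_seq_rectangle:
  assumes l: "l \<in> weight_seqs" and P: "P \<in> reweightable_measures l"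
    and J: "finite J" and A: "\<And>i. i \<in> J \<Longrightarrow> A i \<in> sets borel"
  shows "emeasure (reweight_seq P l) {x. \<forall>i\<in>J. x i \<in> A i} =
    (\<Prod>i\<in>J. emeasure (reweight P (l i)) (A i))"
proof -
  have "{x. \<forall>i\<in>J. x i \<in> A i} = prod_emb UNIV (\<lambda>i. reweight P (l i)) J (PiE J A)"
    using P by (intro prod_emb_UNIV_PiE[symmetric]) simp
  then show ?thesis
    using emeasure_PiM_emb[of UNIV "\<lambda>i. reweight P (l i)" J A] assms
    by (simp add: reweight_seq_def prob_space_reweight)
qed

lemma reweight_seq_eqI:
  fixes l :: "nat \<Rightarrow> 'a::topological_space \<Rightarrow> real"
  assumes l: "l \<in> weight_seqs" and P: "P \<in> reweightable_measures l" and Q: "sets Q = sets seq_space"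
    and eq: "\<And>J B. finite J \<Longrightarrow> (\<And>i. i \<in> J \<Longrightarrow> B i \<in> sets borel) \<Longrightarrow>
      emeasure Q {x. \<forall>i\<in>J. x i \<in> B i} = (\<Prod>i\<in>J. emeasure (reweight P (l i)) (B i))"
  shows "Q = reweight_seq P l"
proof -
  note rw = P
  interpret prob_space "reweight P (l i)" for i by (rule prob_space_reweight[OF l P])
  interpret product_prob_space "\<lambda>i. reweight P (l i)" UNIV by unfold_locales
  show ?thesis
    unfolding reweight_seq_def
  proof (rule PiM_eq)
    show "sets Q = sets (PiM UNIV (\<lambda>i. reweight P (l i)))"
      using sets_reweight_seq[OF rw] Q by (simp add: reweight_seq_def)
    fix J B assume "finite J" "\<And>j. j \<in> J \<Longrightarrow> B j \<in> sets (reweight P (l j))"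
    then show "emeasure Q (prod_emb UNIV (\<lambda>i. reweight P (l i)) J (PiE J B)) =
        (\<Prod>j\<in>J. emeasure (reweight P (l j)) (B j))"
      using rw by (simp add: prod_emb_UNIV_PiE eq)
  qed
qed

section \<open>Permutation invariance and exchangeable events\<close>

text \<open>
  An arbitrary member of \<open>reweightable_measures\<close> may be infinite. The lemma replaces it, as reference
  measure for all the factors, by the probability measure \<open>reweight P (l 0)\<close>.
\<close>

lemma reweight_rebase:
  fixes l :: "nat \<Rightarrow> 'a::topological_space \<Rightarrow> real"
  assumes l: "l \<in> weight_seqs" and P: "P \<in> reweightable_measures l"
  shows "\<exists>c. \<forall>i. reweight P (l i) = density (reweight P (l 0)) (\<lambda>x. c i * (ennreal (l i x) / ennreal (l 0 x)))"
proof -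
  let ?Z = "\<lambda>i. \<integral>\<^sup>+x. ennreal (l i x) \<partial>P"
  have Z: "0 < ?Z i" "?Z i < \<infinity>" for i
    using P by (auto simp: reweightable_measures_def)
  have PB: "P \<in> borel_measures" and sP[measurable_cong]: "sets P = sets borel"
    using P by (auto simp: reweightable_measures_def borel_measures_def)
  note [measurable] = measurable_weight[OF l]
  have "reweight P (l i) = density (reweight P (l 0)) (\<lambda>x. (?Z 0 / ?Z i) * (ennreal (l i x) / ennreal (l 0 x)))" for i
  proof (rule measure_eqI)
    show "sets (reweight P (l i)) =
      sets (density (reweight P (l 0)) (\<lambda>x. (?Z 0 / ?Z i) * (ennreal (l i x) / ennreal (l 0 x))))"
      using P by simp
    fix A assume "A \<in> sets (reweight P (l i))"
    then have A[measurable]: "A \<in> sets borel" using P by simp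
    have eq: "ennreal (l 0 x) * (k * (ennreal (l i x) / ennreal (l 0 x)) * indicator A x) =
        k * (ennreal (l i x) * indicator A x)" for x k
    proof -
      have *: "ennreal (l 0 x) * (ennreal (l i x) / ennreal (l 0 x)) = ennreal (l i x)"
        using weight_pos[OF l, of 0 x] weight_pos[OF l, of i x]
        by (simp add: divide_ennreal ennreal_mult[symmetric])
      have "ennreal (l 0 x) * (k * (ennreal (l i x) / ennreal (l 0 x)) * indicator A x) =
          k * ((ennreal (l 0 x) * (ennreal (l i x) / ennreal (l 0 x))) * indicator A x)"
        by (simp only: mult_ac)
      then show ?thesis by (simp only: *)
    qed
    have "emeasure (density (reweight P (l 0)) (\<lambda>x. (?Z 0 / ?Z i) * (ennreal (l i x) / ennreal (l 0 x)))) A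
       = (\<integral>\<^sup>+x. ((?Z 0 / ?Z i) * (ennreal (l i x) / ennreal (l 0 x))) * indicator A x \<partial>reweight P (l 0))"
      using P by (intro emeasure_density) auto
    also have "\<dots> = (\<integral>\<^sup>+x. ennreal (l 0 x) * (((?Z 0 / ?Z i) * (ennreal (l i x) / ennreal (l 0 x))) * indicator A x) \<partial>P) / ?Z 0"
      by (rule nn_integral_reweight[OF sP]) measurable
    also have "\<dots> = (?Z 0 / ?Z i) * (\<integral>\<^sup>+x\<in>A. ennreal (l i x) \<partial>P) / ?Z 0"
      unfolding eq by (subst nn_integral_cmult) auto
    also have "\<dots> = (\<integral>\<^sup>+x\<in>A. ennreal (l i x) \<partial>P) / ?Z i"
    proof -
      have "z / y * a / z = a / y" if "0 < z" "z < \<infinity>" "0 < y" for a y z :: ennreal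
        using that
        by (metis ennreal_divide_times ennreal_mult_divide_eq ennreal_times_divide infinity_ennreal_def
            less_irrefl mult.commute)
      then show ?thesis using Z[of 0] Z[of i] by blast
    qed
    also have "\<dots> = emeasure (reweight P (l i)) A"
      by (rule emeasure_reweight[OF PB, symmetric]) auto
    finally show "emeasure (reweight P (l i)) A = emeasure (density (reweight P (l 0))
      (\<lambda>x. (?Z 0 / ?Z i) * (ennreal (l i x) / ennreal (l 0 x)))) A" by simp
  qed
  then show ?thesis by (intro exI allI)
qed

text \<open>
  Dividing the law \<open>reweight_seq P l\<close> by the product \<open>W\<close> of the first \<open>n\<close> weights leaves a measure
  that is invariant under permutations of the first \<open>n\<close> coordinates. Indeed the law has the density
  \<open>W * U\<close> with respect to the product \<open>R\<close> below, whose first \<open>n\<close> factors are equal, and \<open>U\<close> is a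
  symmetric function of these coordinates.
\<close>

lemma nn_integral_reweight_seq_permute:
  fixes l :: "nat \<Rightarrow> 'a::topological_space \<Rightarrow> real"
  assumes l: "l \<in> weight_seqs" and P: "P \<in> reweightable_measures l"
    and s: "s permutes {..<n}" and \<phi>: "\<phi> \<in> borel_measurable seq_space"
  shows "(\<integral>\<^sup>+x. \<phi> x / ennreal (\<Prod>i<n. l i (x i)) \<partial>reweight_seq P l) =
    (\<integral>\<^sup>+x. \<phi> (\<lambda>i. x (s i)) / ennreal (\<Prod>i<n. l i (x i)) \<partial>reweight_seq P l)"
proof -
  note [measurable] = measurable_weight[OF l] \<phi>
  obtain c where c: "\<And>i. reweight P (l i) =
      density (reweight P (l 0)) (\<lambda>x. c i * (ennreal (l i x) / ennreal (l 0 x)))"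
    using reweight_rebase[OF l P] by blast
  define M where "M i = (if i < n then reweight P (l 0) else reweight P (l i))" for i
  define g where "g i x = (if i < n then c i * (ennreal (l i x) / ennreal (l 0 x)) else 1)" for i x
  have M: "prob_space (M i)" for i
    unfolding M_def using prob_space_reweight[OF l P] by auto
  have sM[measurable_cong]: "sets (M i) = sets borel" for i
    unfolding M_def using P by simp
  have gm[measurable]: "g i \<in> borel_measurable borel" for i
    unfolding g_def by (cases "i < n") auto
  have dens: "density (M i) (g i) = reweight P (l i)" for i
  proof (cases "i < n")
    case True
    then have "g i = (\<lambda>x. c i * (ennreal (l i x) / ennreal (l 0 x)))"
      by (simp add: g_def fun_eq_iff)
    with True show ?thesis by (simp add: M_def c[of i, symmetric])
  next
    case False
    then have "g i = (\<lambda>x. 1)" by (simp add: g_def fun_eq_iff)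
    with False show ?thesis by (simp add: M_def density_1)
  qed
  define R where "R = PiM UNIV M"
  have sR[measurable_cong]: "sets R = sets seq_space"
    unfolding R_def by (intro sets_PiM_cong) (simp_all add: sM)
  have Rdens: "reweight_seq P l = density R (\<lambda>x. \<Prod>i<n. g i (x i))"
    unfolding R_def reweight_seq_def dens[symmetric]
    by (rule PiM_density) (auto simp: M dens prob_space_reweight[OF l P] g_def)
  define U where "U x = (\<Prod>i<n. c i) * (\<Prod>i<n. 1 / ennreal (l 0 (x i)))" for x :: "nat \<Rightarrow> 'a"
  have U_perm: "U (\<lambda>i. x (s i)) = U x" for x
    unfolding U_def using s prod.permute[OF s, of "\<lambda>i. 1 / ennreal (l 0 (x i))"]
    by (simp add: comp_def)
  have gU: "(\<Prod>i<n. g i (x i)) * (a / ennreal (\<Prod>i<n. l i (x i))) = U x * a" for x and a :: ennreal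
  proof -
    have pos: "0 < (\<Prod>i<n. l i (x i))" using weight_pos[OF l] by (intro prod_pos) auto
    have "(\<Prod>i<n. g i (x i)) = (\<Prod>i<n. c i * (1 / ennreal (l 0 (x i))) * ennreal (l i (x i)))"
      by (intro prod.cong) (auto simp: g_def divide_ennreal_def mult_ac)
    also have "\<dots> = U x * ennreal (\<Prod>i<n. l i (x i))"
      using weight_pos[OF l] by (simp add: U_def prod.distrib prod_ennreal less_imp_le)
    finally have "(\<Prod>i<n. g i (x i)) * (a / ennreal (\<Prod>i<n. l i (x i))) =
        U x * (ennreal (\<Prod>i<n. l i (x i)) * (a / ennreal (\<Prod>i<n. l i (x i))))"
      by (simp add: mult_ac)
    also have "ennreal (\<Prod>i<n. l i (x i)) * (a / ennreal (\<Prod>i<n. l i (x i))) = a"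
      using pos by (metis ennreal_mult_divide_eq ennreal_neq_top ennreal_times_divide ennreal_eq_0_iff mult.commute not_less)
    finally show ?thesis .
  qed
  have Ms: "M (s i) = M i" for i
    using s permutes_in_image[OF s, of i] permutes_not_in[OF s, of i]
    by (cases "i < n") (auto simp: M_def)
  have inv: "distr R R (\<lambda>x i. x (s i)) = R"
    using distr_PiM_reindex[of UNIV M s UNIV] M permutes_inj[OF s]
    by (simp add: Ms R_def restrict_UNIV)
  have ms[measurable]: "(\<lambda>x i. x (s i)) \<in> measurable seq_space (seq_space :: (nat \<Rightarrow> 'a) measure)"
    by (rule measurable_PiM_single') (auto simp: space_PiM)
  have Um[measurable]: "U \<in> borel_measurable seq_space"
    unfolding U_def by measurable
  have Wm: "(\<lambda>x. ennreal (\<Prod>i<n. l i (x i))) \<in> borel_measurable seq_space"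
    by measurable
  have Gm: "(\<lambda>x. \<Prod>i<n. g i (x i)) \<in> borel_measurable seq_space"
    by measurable
  have mR: "borel_measurable R = borel_measurable seq_space"
    by (rule measurable_cong_sets[OF sR refl])
  have *: "(\<integral>\<^sup>+x. \<psi> x / ennreal (\<Prod>i<n. l i (x i)) \<partial>reweight_seq P l) = (\<integral>\<^sup>+x. U x * \<psi> x \<partial>R)"
    if \<psi>: "\<psi> \<in> borel_measurable seq_space" for \<psi>
  proof -
    have "(\<integral>\<^sup>+x. \<psi> x / ennreal (\<Prod>i<n. l i (x i)) \<partial>reweight_seq P l) =
        (\<integral>\<^sup>+x. (\<Prod>i<n. g i (x i)) * (\<psi> x / ennreal (\<Prod>i<n. l i (x i))) \<partial>R)"
      unfolding Rdens
      by (rule nn_integral_density; unfold mR; intro Gm borel_measurable_divide_ennreal \<psi> Wm)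
    then show ?thesis by (simp only: gU)
  qed
  have "(\<integral>\<^sup>+x. U x * \<phi> x \<partial>R) = (\<integral>\<^sup>+x. U x * \<phi> x \<partial>distr R R (\<lambda>x i. x (s i)))"
    by (simp only: inv)
  also have "\<dots> = (\<integral>\<^sup>+x. U (\<lambda>i. x (s i)) * \<phi> (\<lambda>i. x (s i)) \<partial>R)"
  proof (rule nn_integral_distr)
    show "(\<lambda>x i. x (s i)) \<in> measurable R R"
      using ms by (simp only: measurable_cong_sets[OF sR sR])
    show "(\<lambda>x. U x * \<phi> x) \<in> borel_measurable (distr R R (\<lambda>x i. x (s i)))"
      unfolding inv mR by (intro borel_measurable_times_ennreal Um \<phi>)
  qed
  also have "\<dots> = (\<integral>\<^sup>+x. U x * \<phi> (\<lambda>i. x (s i)) \<partial>R)"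
    by (simp only: U_perm)
  finally show ?thesis
    by (simp only: *[OF \<phi>] *[OF measurable_compose[OF ms \<phi>]])
qed

lemma exchangeable_algebra_permute:
  assumes A: "A \<in> exchangeable_algebra" and s: "s permutes {..<n}"
  shows "(\<lambda>i. x (s i)) \<in> A \<longleftrightarrow> x \<in> A"
proof -
  have *: "(\<lambda>i. z (t i)) \<in> A" if "z \<in> A" "t permutes {..<n}" for z t
  proof (cases "n = 0")
    case True
    with that have "t = id" by simp
    with that show ?thesis by simp
  next
    case False
    then have "1 \<le> n" by simp
    with A that show ?thesis unfolding exchangeable_algebra_def by blast
  qed
  have "(\<lambda>i. x (s (inv s i))) = x"
    using permutes_inverses(1)[OF s] by simp
  with *[of "\<lambda>i. x (s i)" "inv s"] *[of x s] show ?thesis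
    using s permutes_inv[OF s] by auto
qed

lemma exchangeable_algebra_Compl:
  fixes A :: "(nat \<Rightarrow> 'a::topological_space) set"
  assumes A: "A \<in> exchangeable_algebra"
  shows "- A \<in> exchangeable_algebra"
proof -
  have "A \<in> sets seq_space" using A by (simp add: exchangeable_algebra_def)
  then have "space seq_space - A \<in> sets seq_space" by (rule sets.compl_sets)
  then show ?thesis
    using exchangeable_algebra_permute[OF A]
    by (auto simp: exchangeable_algebra_def space_PiM Compl_eq_Diff_UNIV)
qed

text \<open>
  Conditioning on an exchangeable event multiplies the law by a symmetric function of the first \<open>n\<close>
  coordinates, for every \<open>n\<close>, and therefore preserves the permutation invariance.
\<close>

lemma weighted_exchangeable_uniform:
  fixes l :: "nat \<Rightarrow> 'a::topological_space \<Rightarrow> real"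
  assumes l: "l \<in> weight_seqs" and P: "P \<in> reweightable_measures l" and A: "A \<in> exchangeable_algebra"
  shows "weighted_exchangeable l (uniform_measure (reweight_seq P l) A)"
proof -
  note lm[measurable] = measurable_weight[OF l]
  let ?R = "reweight_seq P l" and ?Q = "uniform_measure (reweight_seq P l) A"
  have Am[measurable]: "A \<in> sets seq_space" using A by (simp add: exchangeable_algebra_def)
  note sR[measurable_cong] = sets_reweight_seq[OF P]
  have sQ[measurable_cong]: "sets ?Q = sets seq_space" by (simp add: sR)
  have em: "emeasure (density (marginal n ?Q) (\<lambda>x. ennreal (1 / (\<Prod>i<n. l i (x i))))) (PiE {..<n} B) =
      (\<integral>\<^sup>+x. (indicator {x. \<forall>i\<in>{..<n}. x i \<in> B i} x * indicator A x) / ennreal (\<Prod>i<n. l i (x i)) \<partial>?R) /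
      emeasure ?R A" if B: "\<forall>i<n. B i \<in> sets borel" for B n
  proof -
    let ?F = "fin_space n :: (nat \<Rightarrow> 'a) measure"
    let ?h = "\<lambda>x :: nat \<Rightarrow> 'a. ennreal (1 / (\<Prod>i<n. l i (x i)))"
    have Bm: "PiE {..<n} B \<in> sets ?F"
      using B by (intro sets_PiM_I_finite) auto
    have hm: "?h \<in> borel_measurable ?F" by measurable
    have rm: "(\<lambda>x. restrict x {..<n}) \<in> measurable ?Q ?F"
      unfolding measurable_cong_sets[OF sQ refl] by (rule measurable_restrict_subset) simp
    have hBm: "(\<lambda>x. ?h x * indicator (PiE {..<n} B) x) \<in> borel_measurable ?F"
      using hm Bm by (intro borel_measurable_times_ennreal) auto
    have "emeasure (density (marginal n ?Q) ?h) (PiE {..<n} B) =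
        (\<integral>\<^sup>+x. ?h x * indicator (PiE {..<n} B) x \<partial>marginal n ?Q)"
      using hm Bm by (intro emeasure_density) (simp_all add: marginal_def)
    also have "\<dots> = (\<integral>\<^sup>+x. ?h (restrict x {..<n}) * indicator (PiE {..<n} B) (restrict x {..<n}) \<partial>?Q)"
      unfolding marginal_def using hBm by (intro nn_integral_distr[OF rm]) simp
    also have "\<dots> = (\<integral>\<^sup>+x. ?h (restrict x {..<n}) * indicator (PiE {..<n} B) (restrict x {..<n}) *
        indicator A x \<partial>?R) / emeasure ?R A"
    proof (rule nn_integral_uniform_measure)
      have "(\<lambda>x. restrict x {..<n}) \<in> measurable ?R ?F"
        unfolding measurable_cong_sets[OF sR refl] by (rule measurable_restrict_subset) simp
      from measurable_compose[OF this hBm]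
      show "(\<lambda>x. ?h (restrict x {..<n}) * indicator (PiE {..<n} B) (restrict x {..<n})) \<in> borel_measurable ?R" .
    qed (simp add: sR)
    also have "(\<integral>\<^sup>+x. ?h (restrict x {..<n}) * indicator (PiE {..<n} B) (restrict x {..<n}) * indicator A x \<partial>?R) =
        (\<integral>\<^sup>+x. (indicator {x. \<forall>i\<in>{..<n}. x i \<in> B i} x * indicator A x) / ennreal (\<Prod>i<n. l i (x i)) \<partial>?R)"
    proof (rule nn_integral_cong)
      fix x :: "nat \<Rightarrow> 'a"
      have pos: "0 < (\<Prod>i<n. l i (x i))" using weight_pos[OF l] by (intro prod_pos) auto
      then have "?h (restrict x {..<n}) = 1 / ennreal (\<Prod>i<n. l i (x i))"
        using divide_ennreal[of 1 "\<Prod>i<n. l i (x i)"] by simp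
      moreover have "indicator (PiE {..<n} B) (restrict x {..<n}) =
          (indicator {x. \<forall>i\<in>{..<n}. x i \<in> B i} x :: ennreal)"
        by (auto simp: indicator_def PiE_iff)
      ultimately show "?h (restrict x {..<n}) * indicator (PiE {..<n} B) (restrict x {..<n}) * indicator A x =
        (indicator {x. \<forall>i\<in>{..<n}. x i \<in> B i} x * indicator A x) / ennreal (\<Prod>i<n. l i (x i))"
        by (simp add: divide_ennreal_def mult_ac)
    qed
    finally show ?thesis .
  qed
  show ?thesis
    unfolding weighted_exchangeable_def weighted_exchangeable_fin_def exchangeable_def
  proof (intro conjI allI impI)
    fix n :: nat and B and s :: "nat \<Rightarrow> nat"
    assume B: "\<forall>i<n. B i \<in> sets (borel :: 'a measure)" and s: "s permutes {..<n}"
    have sn: "s i < n" if "i < n" for i using permutes_in_image[OF s, of i] that by simp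
    then have Bs: "\<forall>i<n. B (s i) \<in> sets borel" using B by blast
    let ?\<phi> = "\<lambda>x :: nat \<Rightarrow> 'a. indicator {x. \<forall>i\<in>{..<n}. x i \<in> B (s i)} x * indicator A x :: ennreal"
    have "{x. \<forall>i\<in>{..<n}. x i \<in> B (s i)} \<in> sets (seq_space :: (nat \<Rightarrow> 'a) measure)"
      using Bs by (intro rectangle_in_sets) auto
    then have \<phi>: "?\<phi> \<in> borel_measurable seq_space"
      by simp
    have \<phi>s: "?\<phi> (\<lambda>i. x (s i)) = indicator {x. \<forall>i\<in>{..<n}. x i \<in> B i} x * indicator A x" for x
    proof -
      have "(\<forall>i\<in>{..<n}. x (s i) \<in> B (s i)) \<longleftrightarrow> (\<forall>j\<in>s ` {..<n}. x j \<in> B j)" by simp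
      then show ?thesis
        using exchangeable_algebra_permute[OF A s, of x] permutes_image[OF s]
        by (simp add: indicator_def)
    qed
    show "emeasure (density (marginal n ?Q) (\<lambda>x. ennreal (1 / (\<Prod>i<n. l i (x i))))) (PiE {..<n} B) =
      emeasure (density (marginal n ?Q) (\<lambda>x. ennreal (1 / (\<Prod>i<n. l i (x i))))) (PiE {..<n} (\<lambda>i. B (s i)))"
      unfolding em[OF B] em[OF Bs] nn_integral_reweight_seq_permute[OF l P s \<phi>] \<phi>s ..
  qed (simp_all add: sR marginal_def)
qed

section \<open>Maximal inequality for reversed martingales\<close>

text \<open>
  Doob's weak-type maximal inequality for a nonnegative reversed martingale, that is, for
  \<open>X n = E[Y | F n]\<close> with decreasing \<open>F n\<close>. In the proof, the event that some \<open>X n\<close> with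
  \<open>N \<le> n \<le> K\<close> exceeds \<open>c\<close> is split according to the last such \<open>n\<close>: the resulting piece \<open>D n\<close> lies in
  \<open>F n\<close> because \<open>X j\<close> is \<open>F n\<close>-measurable for \<open>j \<ge> n\<close>.
\<close>

lemma (in prob_space) reverse_martingale_maximal:
  fixes X :: "nat \<Rightarrow> 'a \<Rightarrow> ennreal"
  assumes F: "\<And>n. subalgebra M (F n)" and decr: "\<And>m n. m \<le> n \<Longrightarrow> subalgebra (F m) (F n)"
    and X: "\<And>n. X n \<in> borel_measurable (F n)" and Y[measurable]: "Y \<in> borel_measurable M"
    and cond: "\<And>n D. N \<le> n \<Longrightarrow> D \<in> sets (F n) \<Longrightarrow> (\<integral>\<^sup>+x\<in>D. X n x \<partial>M) = (\<integral>\<^sup>+x\<in>D. Y x \<partial>M)"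
  shows "c * emeasure M {x \<in> space M. \<exists>n\<ge>N. c < X n x} \<le> (\<integral>\<^sup>+x. Y x \<partial>M)"
proof -
  have XF: "X n \<in> borel_measurable (F m)" if "m \<le> n" for m n
    using measurable_from_subalg[OF decr[OF that] X] .
  have XM[measurable]: "X n \<in> borel_measurable M" for n
    using measurable_from_subalg[OF F X] .
  define A where "A K = {x \<in> space M. \<exists>n\<in>{N..K}. c < X n x}" for K
  have A[measurable]: "A K \<in> sets M" for K
    unfolding A_def by measurable
  have bound: "c * emeasure M (A K) \<le> (\<integral>\<^sup>+x. Y x \<partial>M)" for K
  proof -
    define D where "D k = {x \<in> space M. c < X k x \<and> (\<forall>j\<in>{k<..K}. X j x \<le> c)}" for k
    have DF: "D k \<in> sets (F k)" for k
    proof -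
      have [measurable]: "X j \<in> borel_measurable (F k)" if "j \<in> {k<..K}" for j
        using XF that by auto
      note X[of k, measurable]
      have "{x \<in> space (F k). c < X k x \<and> (\<forall>j\<in>{k<..K}. X j x \<le> c)} \<in> sets (F k)"
        by measurable
      moreover have "space (F k) = space M"
        using F[of k] by (simp add: subalgebra_def)
      ultimately show ?thesis
        unfolding D_def by (simp only:)
    qed
    then have D[measurable]: "D k \<in> sets M" for k
      using F[of k] by (auto simp: subalgebra_def)
    have disj: "disjoint_family_on D {N..K}"
      by (auto simp: disjoint_family_on_def D_def not_less[symmetric])
    have UN: "(\<Union>k\<in>{N..K}. D k) = A K"
    proof (intro equalityI subsetI)
      fix x assume x: "x \<in> A K"
      let ?S = "{n \<in> {N..K}. c < X n x}"
      have S: "finite ?S" "?S \<noteq> {}"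
        using x by (auto simp: A_def)
      have m: "Max ?S \<in> ?S" using Max_in[OF S] .
      have "X j x \<le> c" if "j \<in> {Max ?S<..K}" for j
      proof (rule ccontr)
        assume "\<not> X j x \<le> c"
        with that m have "j \<in> ?S" by auto
        with Max_ge[OF S(1)] have "j \<le> Max ?S" by blast
        with that show False by auto
      qed
      with m x have "x \<in> D (Max ?S)"
        by (auto simp: D_def A_def)
      with m show "x \<in> (\<Union>k\<in>{N..K}. D k)" by blast
    qed (auto simp: D_def A_def)
    have "c * emeasure M (A K) = c * (\<Sum>k\<in>{N..K}. emeasure M (D k))"
      unfolding UN[symmetric] using disj by (subst sum_emeasure) auto
    also have "\<dots> = (\<Sum>k\<in>{N..K}. (\<integral>\<^sup>+x\<in>D k. c \<partial>M))"
      by (simp add: sum_distrib_left nn_integral_cmult)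
    also have "\<dots> \<le> (\<Sum>k\<in>{N..K}. (\<integral>\<^sup>+x\<in>D k. X k x \<partial>M))"
      by (intro sum_mono nn_integral_mono) (auto simp: D_def indicator_def)
    also have "\<dots> = (\<Sum>k\<in>{N..K}. emeasure (density M Y) (D k))"
      using cond[OF _ DF] by (intro sum.cong) (auto simp: emeasure_density)
    also have "\<dots> = emeasure (density M Y) (A K)"
      unfolding UN[symmetric] using disj by (subst sum_emeasure) auto
    also have "\<dots> \<le> (\<integral>\<^sup>+x. Y x \<partial>M)"
      by (subst emeasure_density) (auto intro!: nn_integral_mono simp: indicator_def)
    finally show ?thesis .
  qed
  have "{x \<in> space M. \<exists>n\<ge>N. c < X n x} = (\<Union>K. A K)"
    by (auto simp: A_def) (meson atLeastAtMost_iff order_refl)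
  moreover have "incseq A"
    by (auto simp: incseq_def A_def)
  ultimately have "emeasure M {x \<in> space M. \<exists>n\<ge>N. c < X n x} = (SUP K. emeasure M (A K))"
    using SUP_emeasure_incseq[of A M] A by (simp add: image_subset_iff)
  then have "c * emeasure M {x \<in> space M. \<exists>n\<ge>N. c < X n x} = (SUP K. c * emeasure M (A K))"
    by (simp add: SUP_mult_left_ennreal)
  also have "\<dots> \<le> (\<integral>\<^sup>+x. Y x \<partial>M)"
    by (intro SUP_least bound)
  finally show ?thesis .
qed

section \<open>Weighted empirical measures\<close>

text \<open>
  The events that are invariant under permutations of the first \<open>n\<close> coordinates. Only the
  sigma-algebra of this measure is used; its measure is identically zero.
\<close>

definition perm_algebra :: "nat \<Rightarrow> (nat \<Rightarrow> 'a::topological_space) measure" where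
  "perm_algebra n = sigma UNIV
     {A \<in> sets seq_space. \<forall>s. s permutes {..<n} \<longrightarrow> (\<forall>x. (\<lambda>i. x (s i)) \<in> A \<longleftrightarrow> x \<in> A)}"

lemma space_perm_algebra [simp]: "space (perm_algebra n) = UNIV"
  by (simp add: perm_algebra_def space_measure_of_conv)

lemma sets_perm_algebra:
  "sets (perm_algebra n :: (nat \<Rightarrow> 'a::topological_space) measure) =
     {A \<in> sets seq_space. \<forall>s. s permutes {..<n} \<longrightarrow> (\<forall>x. (\<lambda>i. x (s i)) \<in> A \<longleftrightarrow> x \<in> A)}"
  (is "_ = ?S")
proof -
  have sp: "space (seq_space :: (nat \<Rightarrow> 'a) measure) = UNIV" by (simp add: space_PiM)
  have "sigma_algebra UNIV ?S"
    unfolding sigma_algebra_iff2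
  proof (intro conjI allI impI)
    fix A :: "nat \<Rightarrow> (nat \<Rightarrow> 'a) set" assume A: "range A \<subseteq> ?S"
    then have "A k \<in> ?S" for k by blast
    then show "(\<Union>k. A k) \<in> ?S" by auto
  qed (use sets.Diff[OF sets.top, of _ "seq_space :: (nat \<Rightarrow> 'a) measure"] in \<open>auto simp: sp\<close>)
  then interpret sigma_algebra UNIV ?S .
  show ?thesis
    unfolding perm_algebra_def by (rule sets_measure_of_eq)
qed

lemma subalgebra_perm_algebra:
  assumes "m \<le> n" shows "subalgebra (perm_algebra m) (perm_algebra n)"
  using permutes_subset[of _ "{..<m}" "{..<n}"] assms
  by (auto simp: subalgebra_def sets_perm_algebra)

lemma measurable_perm_algebraI:
  assumes f: "f \<in> measurable seq_space N"
    and inv: "\<And>s x. s permutes {..<n} \<Longrightarrow> f (\<lambda>i. x (s i)) = f x"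
  shows "f \<in> measurable (perm_algebra n) N"
proof (rule measurableI)
  fix A assume "A \<in> sets N"
  then have "f -` A \<inter> space seq_space \<in> sets seq_space"
    using f by (rule measurable_sets[rotated])
  then show "f -` A \<inter> space (perm_algebra n) \<in> sets (perm_algebra n)"
    by (simp add: sets_perm_algebra space_PiM inv)
qed (use f in \<open>auto simp: measurable_def space_PiM\<close>)

text \<open>
  Grouping the permutations by the value of \<open>s i\<close> turns the definition into a ratio of two sums over
  all permutations, from which the symmetry of the weighted empirical measure can be read off.
\<close>

lemma weighted_empirical_eq:
  assumes "i < n" "A \<in> sets borel"
  shows "weighted_empirical l n i x A =
    (\<Sum>s | s permutes {..<n}. indicator A (x (s i)) * (\<Prod>k<n. l k (x (s k)))) /
    (\<Sum>s | s permutes {..<n}. \<Prod>k<n. l k (x (s k)))"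
proof -
  let ?S = "{s. s permutes {..<n}}" and ?a = "\<lambda>s. \<Prod>k<n. l k (x (s k))"
  have "(\<Sum>s\<in>?S. indicator A (x (s i)) * ?a s) =
      (\<Sum>j<n. \<Sum>s\<in>{s \<in> ?S. s i = j}. indicator A (x (s i)) * ?a s)"
    using assms permutes_in_image[of _ "{..<n}" i]
    by (intro sum.group[symmetric]) (auto simp: finite_permutations)
  also have "\<dots> = (\<Sum>j<n. indicator A (x j) * (\<Sum>s | s permutes {..<n} \<and> s i = j. ?a s))"
    by (auto simp: sum_distrib_left intro!: sum.cong)
  finally show ?thesis
    using assms by (simp add: weighted_empirical_def perm_weight_def measure_return
        sum_divide_distrib mult.commute)
qed

lemma sum_perm_weights_pos:
  assumes "l \<in> weight_seqs"
  shows "0 < (\<Sum>s | s permutes {..<n}. \<Prod>k<n. l k (x (s k)))"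
  using weight_pos[OF assms] permutes_id[of "{..<n}"]
  by (intro sum_pos prod_pos) (auto simp: finite_permutations simp del: permutes_id)

lemma weighted_empirical_permute:
  assumes "i < n" "A \<in> sets borel" and t: "t permutes {..<n}"
  shows "weighted_empirical l n i (\<lambda>k. x (t k)) A = weighted_empirical l n i x A"
  unfolding weighted_empirical_eq[OF assms(1,2)]
  using setum_permutations_compose_left[OF t, of "\<lambda>s. indicator A (x (s i)) * (\<Prod>k<n. l k (x (s k)))"]
    setum_permutations_compose_left[OF t, of "\<lambda>s. \<Prod>k<n. l k (x (s k))"]
  by simp

lemma weighted_empirical_Compl:
  assumes l: "l \<in> weight_seqs" and "i < n" "A \<in> sets borel"
  shows "weighted_empirical l n i x (- A) = 1 - weighted_empirical l n i x A"
proof -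
  have "- A \<in> sets borel" using assms by auto
  moreover have "indicator (- A) y = 1 - (indicator A y :: real)" for y
    by (auto simp: indicator_def)
  ultimately show ?thesis
    using assms sum_perm_weights_pos[OF l, of x n, THEN less_imp_neq]
    by (simp add: weighted_empirical_eq left_diff_distrib sum_subtractf diff_divide_distrib)
qed

lemma weighted_empirical_nonneg:
  assumes l: "l \<in> weight_seqs" and "i < n" "A \<in> sets borel"
  shows "0 \<le> weighted_empirical l n i x A"
  unfolding weighted_empirical_eq[OF assms(2,3)]
  using weight_pos[OF l] by (intro divide_nonneg_nonneg sum_nonneg mult_nonneg_nonneg prod_nonneg) (auto intro: less_imp_le)

lemma measurable_weighted_empirical:
  fixes l :: "nat \<Rightarrow> 'a::topological_space \<Rightarrow> real"
  assumes l: "l \<in> weight_seqs" and A[measurable]: "A \<in> sets borel"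
  shows "(\<lambda>x. weighted_empirical l n i x A) \<in> borel_measurable seq_space"
proof -
  note [measurable] = measurable_weight[OF l]
  have "(\<lambda>x. weighted_empirical l n i x A) = (\<lambda>x. \<Sum>j<n. perm_weight l n i x j * indicator A (x j))"
    using A by (simp add: weighted_empirical_def measure_return)
  also have "\<dots> \<in> borel_measurable seq_space"
    unfolding perm_weight_def by measurable
  finally show ?thesis .
qed

text \<open>
  By averaging the permutation invariance over all \<open>s\<close>, an expectation depends on the integrand only
  through its weighted symmetrization.
\<close>

lemma nn_integral_reweight_seq_eqI:
  fixes l :: "nat \<Rightarrow> 'a::topological_space \<Rightarrow> real"
  assumes l: "l \<in> weight_seqs" and P: "P \<in> reweightable_measures l"
    and f: "f \<in> borel_measurable seq_space" and g: "g \<in> borel_measurable seq_space"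
    and eq: "\<And>x. (\<Sum>s | s permutes {..<n}. f (\<lambda>k. x (s k)) * ennreal (\<Prod>k<n. l k (x (s k)))) =
      (\<Sum>s | s permutes {..<n}. g (\<lambda>k. x (s k)) * ennreal (\<Prod>k<n. l k (x (s k))))"
  shows "(\<integral>\<^sup>+x. f x \<partial>reweight_seq P l) = (\<integral>\<^sup>+x. g x \<partial>reweight_seq P l)"
proof -
  note [measurable] = measurable_weight[OF l]
  define W where "W x = ennreal (\<Prod>k<n. l k (x k))" for x :: "nat \<Rightarrow> 'a"
  have Wm: "W \<in> borel_measurable seq_space"
    unfolding W_def by measurable
  have W0: "W x \<noteq> 0" "W x \<noteq> \<top>" for x
    using prod_pos[of "{..<n}" "\<lambda>k. l k (x k)"] weight_pos[OF l]
    by (simp_all add: W_def ennreal_eq_0_iff not_le)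
  let ?S = "{s. s permutes {..<n}}"
  have ms: "(\<lambda>x i. x (s i)) \<in> measurable seq_space (seq_space :: (nat \<Rightarrow> 'a) measure)" for s
    by (rule measurable_PiM_single') (auto simp: space_PiM)
  have mR: "borel_measurable (reweight_seq P l) = borel_measurable seq_space"
    using sets_reweight_seq[OF P] by (rule measurable_cong_sets) simp
  have avg: "of_nat (card ?S) * (\<integral>\<^sup>+x. h x \<partial>reweight_seq P l) =
      (\<integral>\<^sup>+x. (\<Sum>s\<in>?S. h (\<lambda>k. x (s k)) * ennreal (\<Prod>k<n. l k (x (s k)))) / W x \<partial>reweight_seq P l)"
    if h: "h \<in> borel_measurable seq_space" for h
  proof -
    have hW: "(\<lambda>x. h x * W x) \<in> borel_measurable seq_space"
      by (intro borel_measurable_times_ennreal h Wm)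
    have "(\<integral>\<^sup>+x. h x \<partial>reweight_seq P l) =
        (\<integral>\<^sup>+x. (h (\<lambda>k. x (s k)) * W (\<lambda>k. x (s k))) / W x \<partial>reweight_seq P l)" if "s \<in> ?S" for s
    proof -
      have "(\<integral>\<^sup>+x. h x \<partial>reweight_seq P l) = (\<integral>\<^sup>+x. (h x * W x) / W x \<partial>reweight_seq P l)"
        using W0 by (simp add: ennreal_mult_divide_eq)
      also have "\<dots> = (\<integral>\<^sup>+x. (h (\<lambda>k. x (s k)) * W (\<lambda>k. x (s k))) / W x \<partial>reweight_seq P l)"
        using nn_integral_reweight_seq_permute[OF l P _ hW, of s n] that by (simp add: W_def)
      finally show ?thesis .
    qed
    then have "(\<Sum>s\<in>?S. \<integral>\<^sup>+x. h x \<partial>reweight_seq P l) =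
        (\<Sum>s\<in>?S. \<integral>\<^sup>+x. (h (\<lambda>k. x (s k)) * W (\<lambda>k. x (s k))) / W x \<partial>reweight_seq P l)"
      by (intro sum.cong) auto
    also have "\<dots> = (\<integral>\<^sup>+x. (\<Sum>s\<in>?S. (h (\<lambda>k. x (s k)) * W (\<lambda>k. x (s k))) / W x) \<partial>reweight_seq P l)"
      by (rule nn_integral_sum[symmetric], unfold mR)
        (intro borel_measurable_divide_ennreal Wm measurable_compose[OF ms hW])
    also have "\<dots> = (\<integral>\<^sup>+x. (\<Sum>s\<in>?S. h (\<lambda>k. x (s k)) * W (\<lambda>k. x (s k))) / W x \<partial>reweight_seq P l)"
      by (simp add: divide_ennreal_def sum_distrib_right)
    finally show ?thesis
      by (simp add: W_def)
  qed
  have "of_nat (card ?S) * (\<integral>\<^sup>+x. f x \<partial>reweight_seq P l) =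
      of_nat (card ?S) * (\<integral>\<^sup>+x. g x \<partial>reweight_seq P l)"
    by (simp only: avg[OF f] avg[OF g] eq)
  moreover have "(of_nat (card ?S) :: ennreal) \<noteq> 0"
    by (simp add: card_permutations)
  ultimately show ?thesis
    by (simp only: ennreal_mult_cancel_left) (simp add: ennreal_of_nat_eq_real_of_nat)
qed

text \<open>
  This says that \<open>weighted_empirical l n i x A\<close> is the conditional probability of \<open>x i \<in> A\<close> given
  \<open>perm_algebra n\<close>.
\<close>

lemma nn_integral_weighted_empirical:
  fixes l :: "nat \<Rightarrow> 'a::topological_space \<Rightarrow> real"
  assumes l: "l \<in> weight_seqs" and P: "P \<in> reweightable_measures l"
    and i: "i < n" and A[measurable]: "A \<in> sets borel" and D: "D \<in> sets (perm_algebra n)"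
  shows "(\<integral>\<^sup>+x\<in>D. ennreal (weighted_empirical l n i x A) \<partial>reweight_seq P l) =
    (\<integral>\<^sup>+x\<in>D. indicator A (x i) \<partial>reweight_seq P l)"
proof (rule nn_integral_reweight_seq_eqI[OF l P, where n = n])
  have Dm[measurable]: "D \<in> sets seq_space" using D by (simp add: sets_perm_algebra)
  note measurable_weighted_empirical[OF l A, measurable]
  show "(\<lambda>x. ennreal (weighted_empirical l n i x A) * indicator D x) \<in> borel_measurable seq_space"
    by measurable
  show "(\<lambda>x. indicator A (x i) * indicator D x :: ennreal) \<in> borel_measurable seq_space"
    by measurable
  fix x :: "nat \<Rightarrow> 'a"
  let ?S = "{s. s permutes {..<n}}" and ?a = "\<lambda>s. \<Prod>k<n. l k (x (s k))"
  have a0: "0 \<le> ?a s" for s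
    using weight_pos[OF l] by (intro prod_nonneg) (auto intro: less_imp_le)
  have Dinv: "indicator D (\<lambda>k. x (s k)) = (indicator D x :: ennreal)" if "s \<in> ?S" for s
    using D that by (auto simp: sets_perm_algebra indicator_def)
  have "(\<Sum>s\<in>?S. ennreal (weighted_empirical l n i (\<lambda>k. x (s k)) A) * indicator D (\<lambda>k. x (s k)) *
      ennreal (?a s)) = (\<Sum>s\<in>?S. ennreal (weighted_empirical l n i x A) * indicator D x * ennreal (?a s))"
    using i A by (intro sum.cong) (auto simp: Dinv weighted_empirical_permute)
  also have "\<dots> = indicator D x * ennreal (weighted_empirical l n i x A * (\<Sum>s\<in>?S. ?a s))"
    using a0 weighted_empirical_nonneg[OF l i A]
    by (simp add: sum_distrib_left[symmetric] sum_ennreal ennreal_mult sum_nonneg mult_ac)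
  also have "weighted_empirical l n i x A * (\<Sum>s\<in>?S. ?a s) = (\<Sum>s\<in>?S. indicator A (x (s i)) * ?a s)"
    using sum_perm_weights_pos[OF l, of x n, THEN less_imp_neq]
    by (simp add: weighted_empirical_eq[OF i A])
  also have "indicator D x * ennreal \<dots> = (\<Sum>s\<in>?S. indicator A (x (s i)) * indicator D x * ennreal (?a s))"
  proof -
    have "ennreal (\<Sum>s\<in>?S. indicator A (x (s i)) * ?a s) = (\<Sum>s\<in>?S. indicator A (x (s i)) * ennreal (?a s))"
      using a0 by (subst sum_ennreal[symmetric]) (auto simp: ennreal_mult ennreal_indicator)
    then show ?thesis by (simp add: sum_distrib_left mult_ac)
  qed
  also have "\<dots> = (\<Sum>s\<in>?S. indicator A (x (s i)) * indicator D (\<lambda>k. x (s k)) * ennreal (?a s))"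
    by (intro sum.cong) (auto simp: Dinv)
  finally show "(\<Sum>s\<in>?S. ennreal (weighted_empirical l n i (\<lambda>k. x (s k)) A) * indicator D (\<lambda>k. x (s k)) *
      ennreal (?a s)) = (\<Sum>s\<in>?S. indicator A (x (s i)) * indicator D (\<lambda>k. x (s k)) * ennreal (?a s))" .
qed

section \<open>From the zero-one law to the law of large numbers\<close>

text \<open>
  The event \<open>E\<close> that the weighted empirical masses exceed \<open>c\<close> infinitely often is exactly
  invariant under finite permutations, hence has probability 0 or 1. Probability 1 would, by the maximal
  inequality, give \<open>c \<le> P(x i \<in> A)\<close>.
\<close>

lemma AE_weighted_empirical_le:
  fixes l :: "nat \<Rightarrow> 'a::topological_space \<Rightarrow> real"
  assumes l01: "l \<in> weights_01" and P: "P \<in> reweightable_measures l" and A[measurable]: "A \<in> sets borel"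
    and c: "measure (reweight P (l i)) A < c"
  shows "AE x in reweight_seq P l. \<forall>\<^sub>F n in sequentially. weighted_empirical l n i x A \<le> c"
proof -
  have l: "l \<in> weight_seqs" using l01 by (simp add: weights_01_def)
  interpret prob_space "reweight_seq P l" by (rule prob_space_reweight_seq[OF l P])
  interpret \<kappa>: prob_space "reweight P (l i)" by (rule prob_space_reweight[OF l P])
  note wm[measurable] = measurable_weighted_empirical[OF l A]
  note sR[measurable_cong] = sets_reweight_seq[OF P]
  let ?w = "\<lambda>n x. weighted_empirical l n i x A"
  have c0: "0 < c" using c measure_nonneg[of "reweight P (l i)" A] by linarith
  define E where "E = {x. \<exists>\<^sub>\<infinity>n. c < ?w n x}"
  have Em: "E \<in> sets seq_space"
  proof -
    have "{x \<in> space seq_space. \<exists>\<^sub>\<infinity>n. c < ?w n x} \<in> sets seq_space"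
      unfolding INFM_nat by measurable
    then show ?thesis by (simp add: E_def space_PiM)
  qed
  have "E \<in> exchangeable_algebra"
    unfolding exchangeable_algebra_def
  proof (intro CollectI conjI ballI allI impI Em)
    fix x and m :: nat and s :: "nat \<Rightarrow> nat" assume x: "x \<in> E" and s: "s permutes {..<m}"
    have "?w n (\<lambda>i. x (s i)) = ?w n x" if "n \<ge> max m (Suc i)" for n
      using that s by (intro weighted_empirical_permute permutes_subset[OF s]) auto
    then have "\<forall>\<^sub>F n in sequentially. ?w n (\<lambda>i. x (s i)) = ?w n x"
      unfolding eventually_sequentially by blast
    with x show "(\<lambda>i. x (s i)) \<in> E"
      unfolding E_def mem_Collect_eq cofinite_eq_sequentially
      by (elim frequently_rev_mp) (auto elim: eventually_mono)
  qed
  then have "emeasure (reweight_seq P l) E \<in> {0, 1}"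
    using l01 P unfolding weights_01_def by blast
  moreover have "emeasure (reweight_seq P l) E \<noteq> 1"
  proof
    assume E1: "emeasure (reweight_seq P l) E = 1"
    \<comment> \<open>The weighted empirical masses are meaningful, and measurable for \<open>perm_algebra n\<close>, only for \<open>i < n\<close>.\<close>
    let ?X = "\<lambda>n x. if i < n then ennreal (?w n x) else 0"
    have max: "ennreal c * emeasure (reweight_seq P l)
        {x \<in> space (reweight_seq P l). \<exists>n\<ge>Suc i. ennreal c < ?X n x} \<le>
        (\<integral>\<^sup>+x. indicator A (x i) \<partial>reweight_seq P l)"
    proof (rule reverse_martingale_maximal[where F = perm_algebra])
      show "subalgebra (reweight_seq P l) (perm_algebra n)" for n
        using P by (auto simp: subalgebra_def sets_perm_algebra sR)
      show "subalgebra (perm_algebra m) (perm_algebra n)" if "m \<le> n" for m n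
        using that by (rule subalgebra_perm_algebra)
      show "?X n \<in> borel_measurable (perm_algebra n)" for n
        by (rule measurable_perm_algebraI) (auto simp: weighted_empirical_permute)
      show "(\<lambda>x. indicator A (x i)) \<in> borel_measurable (reweight_seq P l)"
        by measurable
      show "(\<integral>\<^sup>+x\<in>D. ?X n x \<partial>reweight_seq P l) = (\<integral>\<^sup>+x\<in>D. indicator A (x i) \<partial>reweight_seq P l)"
        if "Suc i \<le> n" "D \<in> sets (perm_algebra n)" for n D
        using nn_integral_weighted_empirical[OF l P _ A that(2)] that by simp
    qed
    have "E \<subseteq> {x \<in> space (reweight_seq P l). \<exists>n\<ge>Suc i. ennreal c < ?X n x}"
    proof
      fix x assume "x \<in> E"
      then obtain n where "n > i" "c < ?w n x"
        unfolding E_def INFM_nat by auto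
      then show "x \<in> {x \<in> space (reweight_seq P l). \<exists>n\<ge>Suc i. ennreal c < ?X n x}"
        using P c0 by (auto simp: ennreal_less_iff intro!: exI[of _ n])
    qed
    then have "emeasure (reweight_seq P l) E \<le> emeasure (reweight_seq P l)
        {x \<in> space (reweight_seq P l). \<exists>n\<ge>Suc i. ennreal c < ?X n x}"
      by (rule emeasure_mono) measurable
    then have "ennreal c \<le> ennreal c * emeasure (reweight_seq P l)
        {x \<in> space (reweight_seq P l). \<exists>n\<ge>Suc i. ennreal c < ?X n x}"
      unfolding E1 using mult_left_mono[of 1 _ "ennreal c"] by auto
    also note max
    also have "(\<integral>\<^sup>+x. indicator A (x i) \<partial>reweight_seq P l) =
        (\<integral>\<^sup>+x. indicator {x. \<forall>j\<in>{i}. x j \<in> A} x \<partial>reweight_seq P l)"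
      by (intro nn_integral_cong) (auto simp: indicator_def)
    also have "\<dots> = emeasure (reweight P (l i)) A"
    proof -
      have "{x. \<forall>j\<in>{i}. x j \<in> A} \<in> sets (reweight_seq P l)"
        using rectangle_in_sets[of "{i}" "\<lambda>_. A"] A by (simp add: sR)
      then show ?thesis
        using emeasure_reweight_seq_rectangle[OF l P, of "{i}" "\<lambda>_. A"] by simp
    qed
    finally show False
      using c c0 by (simp add: \<kappa>.emeasure_eq_measure)
  qed
  ultimately have "emeasure (reweight_seq P l) E = 0" by blast
  then have "AE x in reweight_seq P l. x \<notin> E"
    using Em by (intro AE_not_in) (auto simp: null_sets_def sR)
  then show ?thesis
    by eventually_elim (auto simp: E_def cofinite_eq_sequentially not_frequently not_less)
qed

lemma weights_01_subset_LLN: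
  "(weights_01 :: (nat \<Rightarrow> 'a::topological_space \<Rightarrow> real) set) \<subseteq> weights_LLN"
proof
  fix l :: "nat \<Rightarrow> 'a \<Rightarrow> real" assume l01: "l \<in> weights_01"
  then have l: "l \<in> weight_seqs" by (simp add: weights_01_def)
  show "l \<in> weights_LLN"
    unfolding weights_LLN_def
  proof (intro CollectI conjI ballI allI l)
    fix P and i :: nat and A :: "'a set"
    assume P: "P \<in> reweightable_measures l" and A: "A \<in> sets borel"
    interpret \<kappa>: prob_space "reweight P (l i)" by (rule prob_space_reweight[OF l P])
    let ?w = "\<lambda>n x. weighted_empirical l n i x A" and ?m = "measure (reweight P (l i)) A"
    have cA: "- A \<in> sets borel" using A by auto
    have m': "measure (reweight P (l i)) (- A) = 1 - ?m"
      using \<kappa>.prob_compl[of A] A P by (simp add: Compl_eq_Diff_UNIV)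
    have "AE x in reweight_seq P l. \<forall>k. \<forall>\<^sub>F n in sequentially. \<bar>?w n x - ?m\<bar> \<le> 1 / Suc k"
      unfolding AE_all_countable
    proof
      fix k
      have "AE x in reweight_seq P l. \<forall>\<^sub>F n in sequentially. ?w n x \<le> ?m + 1 / Suc k"
        by (rule AE_weighted_empirical_le[OF l01 P A]) simp
      \<comment> \<open>The lower bound for \<open>A\<close> is the upper bound for the complement.\<close>
      moreover have "AE x in reweight_seq P l. \<forall>\<^sub>F n in sequentially.
          weighted_empirical l n i x (- A) \<le> (1 - ?m) + 1 / Suc k"
        by (rule AE_weighted_empirical_le[OF l01 P cA]) (simp add: m')
      ultimately show "AE x in reweight_seq P l. \<forall>\<^sub>F n in sequentially. \<bar>?w n x - ?m\<bar> \<le> 1 / Suc k"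
      proof eventually_elim
        case (elim x)
        then show ?case
          using eventually_gt_at_top[of i]
        proof eventually_elim
          case (elim n)
          then show ?case using weighted_empirical_Compl[OF l _ A, of i n x] by auto
        qed
      qed
    qed
    then show "AE x in reweight_seq P l. (\<lambda>n. ?w n x) \<longlonglongrightarrow> ?m"
    proof eventually_elim
      case (elim x)
      show ?case
      proof (rule tendstoI)
        fix e :: real assume "0 < e"
        then obtain k where "1 / Suc k < e"
          using nat_approx_posE by blast
        then show "\<forall>\<^sub>F n in sequentially. dist (?w n x) ?m < e"
          using elim[rule_format, of k] by (auto simp: dist_real_def elim: eventually_mono)
      qed
    qed
  qed
qed

section \<open>Mixtures of product laws\<close>

lemma space_borel_measures_algebra [simp]:
  "space (borel_measures_algebra :: 'a::topological_space measure measure) = borel_measures"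
  by (simp add: borel_measures_algebra_def space_measure_of_conv)

lemma measurable_emeasure_borel_measures:
  assumes A: "A \<in> sets (borel :: 'a::topological_space measure)"
  shows "(\<lambda>P. emeasure P A) \<in> borel_measurable borel_measures_algebra"
proof (rule borel_measurableI_le)
  fix y :: ennreal
  let ?B = "borel_measures_algebra :: 'a measure measure"
  show "{P \<in> space ?B. emeasure P A \<le> y} \<in> sets ?B"
  proof (cases y)
    case (real t)
    then have "{P \<in> borel_measures. emeasure P A \<le> y} \<in>
        {{P \<in> borel_measures. emeasure P A \<le> ennreal t} | A t. A \<in> sets borel \<and> 0 \<le> t}"
      using A by auto
    then show ?thesis
      unfolding borel_measures_algebra_def
      by (auto simp: space_measure_of_conv intro!: in_measure_of)
  next
    case top
    then have "{P \<in> space ?B. emeasure P A \<le> y} = space ?B" by auto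
    then show ?thesis by (simp only: sets.top)
  qed
qed

lemma measurable_nn_integral_borel_measures:
  assumes h: "h \<in> borel_measurable (borel :: 'a::topological_space measure)"
  shows "(\<lambda>P. \<integral>\<^sup>+x. h x \<partial>P) \<in> borel_measurable borel_measures_algebra" (is "?I h \<in> borel_measurable ?B")
  using h
proof induct
  case (cong f g)
  then have "f = g" by auto
  with cong show ?case by simp
next
  case (set A)
  then have "?I (indicator A) \<in> borel_measurable ?B \<longleftrightarrow> (\<lambda>P. emeasure P A) \<in> borel_measurable ?B"
    by (intro measurable_cong nn_integral_indicator) (simp add: borel_measures_def)
  with set show ?case
    by (simp add: measurable_emeasure_borel_measures)
next
  case (mult f c)
  then have "?I (\<lambda>x. c * f x) \<in> borel_measurable ?B \<longleftrightarrow> (\<lambda>P. c * ?I f P) \<in> borel_measurable ?B"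
    by (intro measurable_cong nn_integral_cmult) (auto simp: borel_measures_def cong: measurable_cong_sets)
  with mult show ?case by simp
next
  case (add f g)
  then have "?I (\<lambda>x. g x + f x) \<in> borel_measurable ?B \<longleftrightarrow> (\<lambda>P. ?I g P + ?I f P) \<in> borel_measurable ?B"
    by (intro measurable_cong nn_integral_add) (auto simp: borel_measures_def cong: measurable_cong_sets)
  with add show ?case by simp
next
  case (seq F)
  then have "?I (SUP i. F i) \<in> borel_measurable ?B \<longleftrightarrow> (\<lambda>P. SUP i. ?I (F i) P) \<in> borel_measurable ?B"
    unfolding SUP_apply
    by (intro measurable_cong nn_integral_monotone_convergence_SUP)
       (auto simp: borel_measures_def cong: measurable_cong_sets)
  with seq show ?case by (simp add: image_comp)
qed

lemma space_mixing:
  "mixing_distribution l \<mu> \<Longrightarrow> space \<mu> = reweightable_measures l"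
  by (auto simp: mixing_distribution_def space_restrict_space reweightable_measures_def
      dest!: sets_eq_imp_space_eq)

lemma measurable_nn_integral_mixing:
  fixes l :: "nat \<Rightarrow> 'a::topological_space \<Rightarrow> real"
  assumes \<mu>: "mixing_distribution l \<mu>" and h: "h \<in> borel_measurable borel"
  shows "(\<lambda>P. \<integral>\<^sup>+x. h x \<partial>P) \<in> borel_measurable \<mu>"
proof -
  have "sets \<mu> = sets (restrict_space borel_measures_algebra (reweightable_measures l))"
    using \<mu> by (simp add: mixing_distribution_def)
  then show ?thesis
    unfolding measurable_cong_sets[OF _ refl, of \<mu>]
    by (simp add: measurable_cong_sets[OF _ refl, of \<mu>] measurable_restrict_space1
        measurable_nn_integral_borel_measures[OF h])
qed

lemma measurable_nn_integral_reweight: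
  assumes l: "l \<in> weight_seqs" and \<mu>: "mixing_distribution l \<mu>" and h: "h \<in> borel_measurable borel"
  shows "(\<lambda>P. \<integral>\<^sup>+x. h x \<partial>reweight P (l i)) \<in> borel_measurable \<mu>"
proof -
  note [measurable] = measurable_weight[OF l] h
  have "(\<lambda>P. (\<integral>\<^sup>+x. ennreal (l i x) * h x \<partial>P) / (\<integral>\<^sup>+x. ennreal (l i x) \<partial>P)) \<in> borel_measurable \<mu>"
    by (intro borel_measurable_divide_ennreal measurable_nn_integral_mixing[OF \<mu>]) measurable
  then show ?thesis
    by (rule measurable_cong[THEN iffD1, rotated])
       (auto simp: space_mixing[OF \<mu>] reweightable_measures_def borel_measures_def
         nn_integral_reweight[OF _ measurable_weight[OF l] h])
qed

lemma measurable_emeasure_reweight: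
  fixes l :: "nat \<Rightarrow> 'a::topological_space \<Rightarrow> real"
  assumes l: "l \<in> weight_seqs" and \<mu>: "mixing_distribution l \<mu>" and A: "A \<in> sets borel"
  shows "(\<lambda>P. emeasure (reweight P (l i)) A) \<in> borel_measurable \<mu>"
proof -
  have "(\<lambda>P. \<integral>\<^sup>+x. indicator A x \<partial>reweight P (l i)) \<in> borel_measurable \<mu>"
    using A by (intro measurable_nn_integral_reweight[OF l \<mu>]) auto
  then show ?thesis
    by (rule measurable_cong[THEN iffD1, rotated])
       (use A space_mixing[OF \<mu>] in auto)
qed

text \<open>
  \<open>mixture\<close> is a \<open>measure_of\<close>, which is the zero measure when the given set function is not countably
  additive. Since the mixture is assumed to be a probability measure, this case is excluded, and
  no measurability of the integrand has to be shown.
\<close>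

lemma emeasure_mixture:
  fixes l :: "nat \<Rightarrow> 'a::topological_space \<Rightarrow> real"
  assumes Q: "prob_space (mixture l \<mu>)" and A: "A \<in> sets seq_space"
  shows "emeasure (mixture l \<mu>) A = (\<integral>\<^sup>+P. emeasure (reweight_seq P l) A \<partial>\<mu>)"
proof -
  let ?S = "seq_space :: (nat \<Rightarrow> 'a) measure" and ?e = "\<lambda>A. \<integral>\<^sup>+P. emeasure (reweight_seq P l) A \<partial>\<mu>"
  have S: "sigma_sets UNIV (sets ?S) = sets ?S"
    using sets.sigma_sets_eq[of ?S] by (simp add: space_PiM)
  have em: "emeasure (mixture l \<mu>) B =
      (if B \<in> sets ?S \<and> measure_space UNIV (sets ?S) ?e then ?e B else 0)" for B
    using sets.space_closed[of ?S]
    by (simp add: mixture_def emeasure_measure_of_conv S space_PiM)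
  have "emeasure (mixture l \<mu>) (space (mixture l \<mu>)) \<noteq> 0"
    using prob_space.emeasure_space_1[OF Q] by simp
  then have "measure_space UNIV (sets ?S) ?e"
    unfolding em by (auto split: if_splits)
  with A show ?thesis by (simp add: em)
qed

text \<open>
  A mixture identity for the masses of Borel sets extends to integrals of nonnegative functions.
\<close>

lemma nn_integral_mixing_extend:
  assumes l: "l \<in> weight_seqs" and \<mu>: "mixing_distribution l \<mu>"
    and \<phi>[measurable]: "\<phi> \<in> borel_measurable \<mu>" and \<nu>: "sets \<nu> = sets borel"
    and eq: "\<And>B. B \<in> sets borel \<Longrightarrow>
      (\<integral>\<^sup>+P. emeasure (reweight P (l i)) B * \<phi> P \<partial>\<mu>) = c * emeasure \<nu> B"
    and h: "h \<in> borel_measurable borel"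
  shows "(\<integral>\<^sup>+P. (\<integral>\<^sup>+x. h x \<partial>reweight P (l i)) * \<phi> P \<partial>\<mu>) = c * (\<integral>\<^sup>+x. h x \<partial>\<nu>)"
  using h
proof induct
  case (cong f g)
  then have "f = g" by auto
  with cong show ?case by simp
next
  case (set A)
  have "(\<integral>\<^sup>+P. (\<integral>\<^sup>+x. indicator A x \<partial>reweight P (l i)) * \<phi> P \<partial>\<mu>) =
      (\<integral>\<^sup>+P. emeasure (reweight P (l i)) A * \<phi> P \<partial>\<mu>)"
    using set by (intro nn_integral_cong) (simp add: space_mixing[OF \<mu>])
  with set show ?case by (simp add: eq \<nu>)
next
  case (mult f k)
  note m = measurable_nn_integral_reweight[OF l \<mu> mult(2), of i, measurable]
  have "(\<integral>\<^sup>+P. (\<integral>\<^sup>+x. k * f x \<partial>reweight P (l i)) * \<phi> P \<partial>\<mu>) =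
      (\<integral>\<^sup>+P. k * ((\<integral>\<^sup>+x. f x \<partial>reweight P (l i)) * \<phi> P) \<partial>\<mu>)"
    using mult by (intro nn_integral_cong)
      (simp add: space_mixing[OF \<mu>] nn_integral_cmult mult.assoc cong: measurable_cong_sets)
  also have "\<dots> = k * (\<integral>\<^sup>+P. (\<integral>\<^sup>+x. f x \<partial>reweight P (l i)) * \<phi> P \<partial>\<mu>)"
    by (intro nn_integral_cmult) measurable
  finally show ?case
    using mult by (simp add: nn_integral_cmult \<nu> mult_ac cong: measurable_cong_sets)
next
  case (add f g)
  note m = measurable_nn_integral_reweight[OF l \<mu> add(1), of i, measurable]
    measurable_nn_integral_reweight[OF l \<mu> add(4), of i, measurable]
  have "(\<integral>\<^sup>+P. (\<integral>\<^sup>+x. g x + f x \<partial>reweight P (l i)) * \<phi> P \<partial>\<mu>) =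
      (\<integral>\<^sup>+P. (\<integral>\<^sup>+x. g x \<partial>reweight P (l i)) * \<phi> P + (\<integral>\<^sup>+x. f x \<partial>reweight P (l i)) * \<phi> P \<partial>\<mu>)"
    using add by (intro nn_integral_cong)
      (simp add: space_mixing[OF \<mu>] nn_integral_add distrib_right cong: measurable_cong_sets)
  also have "\<dots> = (\<integral>\<^sup>+P. (\<integral>\<^sup>+x. g x \<partial>reweight P (l i)) * \<phi> P \<partial>\<mu>) +
      (\<integral>\<^sup>+P. (\<integral>\<^sup>+x. f x \<partial>reweight P (l i)) * \<phi> P \<partial>\<mu>)"
    by (intro nn_integral_add) measurable
  finally show ?case
    using add by (simp add: nn_integral_add \<nu> distrib_left cong: measurable_cong_sets)
next
  case (seq F)
  have m: "(\<lambda>P. \<integral>\<^sup>+x. F k x \<partial>reweight P (l i)) \<in> borel_measurable \<mu>" for k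
    by (rule measurable_nn_integral_reweight[OF l \<mu> seq(1)])
  have "(\<integral>\<^sup>+P. (\<integral>\<^sup>+x. (SUP k. F k) x \<partial>reweight P (l i)) * \<phi> P \<partial>\<mu>) =
      (\<integral>\<^sup>+P. (SUP k. (\<integral>\<^sup>+x. F k x \<partial>reweight P (l i)) * \<phi> P) \<partial>\<mu>)"
    using seq by (intro nn_integral_cong)
      (simp add: space_mixing[OF \<mu>] nn_integral_monotone_convergence_SUP SUP_apply
        SUP_mult_right_ennreal image_comp cong: measurable_cong_sets)
  also have "\<dots> = (SUP k. \<integral>\<^sup>+P. (\<integral>\<^sup>+x. F k x \<partial>reweight P (l i)) * \<phi> P \<partial>\<mu>)"
    using seq(4) by (intro nn_integral_monotone_convergence_SUP borel_measurable_times_ennreal m \<phi>)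
      (auto simp: incseq_def le_fun_def intro!: mult_right_mono nn_integral_mono)
  also have "\<dots> = c * (SUP k. \<integral>\<^sup>+x. F k x \<partial>\<nu>)"
    using seq by (simp add: SUP_mult_left_ennreal)
  also have "(SUP k. \<integral>\<^sup>+x. F k x \<partial>\<nu>) = (\<integral>\<^sup>+x. (SUP k. F k) x \<partial>\<nu>)"
    using seq by (simp add: nn_integral_monotone_convergence_SUP SUP_apply image_comp \<nu> cong: measurable_cong_sets)
  finally show ?case .
qed

lemma emeasure_mixture_rectangle:
  fixes l :: "nat \<Rightarrow> 'a::topological_space \<Rightarrow> real"
  assumes l: "l \<in> weight_seqs" and \<mu>: "mixing_distribution l \<mu>" and Q: "prob_space (mixture l \<mu>)"
    and J: "finite J" and B: "\<And>i. i \<in> J \<Longrightarrow> B i \<in> sets borel"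
  shows "emeasure (mixture l \<mu>) {x. \<forall>i\<in>J. x i \<in> B i} =
    (\<integral>\<^sup>+P. (\<Prod>i\<in>J. emeasure (reweight P (l i)) (B i)) \<partial>\<mu>)"
proof -
  have "emeasure (mixture l \<mu>) {x. \<forall>i\<in>J. x i \<in> B i} =
      (\<integral>\<^sup>+P. emeasure (reweight_seq P l) {x. \<forall>i\<in>J. x i \<in> B i} \<partial>\<mu>)"
    by (rule emeasure_mixture[OF Q rectangle_in_sets[of J B, OF J B]])
  also have "\<dots> = (\<integral>\<^sup>+P. (\<Prod>i\<in>J. emeasure (reweight P (l i)) (B i)) \<partial>\<mu>)"
    using emeasure_reweight_seq_rectangle[OF l _ J, of _ B] B
    by (intro nn_integral_cong) (simp add: space_mixing[OF \<mu>])
  finally show ?thesis .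
qed

lemma AE_zero_of_nn_integral_add_le:
  assumes [measurable]: "w \<in> borel_measurable M" "d \<in> borel_measurable M"
    and le: "(\<integral>\<^sup>+x. w x + d x \<partial>M) \<le> (\<integral>\<^sup>+x. w x \<partial>M)" and fin: "(\<integral>\<^sup>+x. w x \<partial>M) \<noteq> \<infinity>"
  shows "AE x in M. d x = (0 :: ennreal)"
proof -
  have "(\<integral>\<^sup>+x. w x \<partial>M) + (\<integral>\<^sup>+x. d x \<partial>M) \<le> (\<integral>\<^sup>+x. w x \<partial>M) + 0"
    using le by (simp add: nn_integral_add)
  then have "(\<integral>\<^sup>+x. d x \<partial>M) = 0"
    using fin by (simp only: ennreal_add_left_cancel_le) simp
  then show ?thesis by (simp add: nn_integral_0_iff_AE)
qed

text \<open>
  The change of weights from \<open>l j\<close> to \<open>l i\<close>; the constant is the ratio of the two normalizations.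
\<close>

lemma nn_integral_reweight_ratio:
  assumes l: "l \<in> weight_seqs" and P: "P \<in> reweightable_measures l" and A[measurable]: "A \<in> sets borel"
  shows "(\<integral>\<^sup>+x. ennreal (l i x / l j x) * indicator A x \<partial>reweight P (l j)) =
    emeasure (reweight P (l i)) A * ((\<integral>\<^sup>+x. ennreal (l i x) \<partial>P) / (\<integral>\<^sup>+x. ennreal (l j x) \<partial>P))"
proof -
  note [measurable] = measurable_weight[OF l]
  let ?Z = "\<lambda>i. \<integral>\<^sup>+x. ennreal (l i x) \<partial>P"
  have Z: "0 < ?Z i" "?Z i < \<infinity>" and PB: "P \<in> borel_measures" "sets P = sets borel"
    using P by (auto simp: reweightable_measures_def borel_measures_def)
  have "ennreal (l j x) * (ennreal (l i x / l j x) * indicator A x) = ennreal (l i x) * indicator A x" for x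
    using weight_pos[OF l, of i x] weight_pos[OF l, of j x]
    by (simp add: mult.assoc[symmetric] ennreal_mult[symmetric])
  then have "(\<integral>\<^sup>+x. ennreal (l i x / l j x) * indicator A x \<partial>reweight P (l j)) =
      (\<integral>\<^sup>+x\<in>A. ennreal (l i x) \<partial>P) / ?Z j"
    by (subst nn_integral_reweight[OF PB(2)]) auto
  also have "\<dots> = ((\<integral>\<^sup>+x\<in>A. ennreal (l i x) \<partial>P) / ?Z i) * (?Z i / ?Z j)"
  proof -
    have "a / z = (a / y) * (y / z)" if "0 < y" "y < \<infinity>" for a y z :: ennreal
      using that
      by (metis ennreal_divide_times ennreal_mult_divide_eq ennreal_times_divide infinity_ennreal_def
          less_irrefl mult.commute)
    then show ?thesis using Z by blast
  qed
  also have "(\<integral>\<^sup>+x\<in>A. ennreal (l i x) \<partial>P) / ?Z i = emeasure (reweight P (l i)) A"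
    by (rule emeasure_reweight[OF PB(1), symmetric]) auto
  finally show ?thesis .
qed

text \<open>
  If under the mixing measure two different coordinates have the joint marginal of the single
  product \<open>reweight_seq P l\<close>, then almost every mixing component has the same marginals as \<open>P\<close>.
  With \<open>y P'\<close> the ratio of the normalizations of \<open>l i\<close> and \<open>l j\<close> under \<open>P'\<close>, the hypothesis gives
  \<open>E[y] = c\<close> and \<open>E[1 / y] = 1 / c\<close>, where \<open>c = y P\<close>. By the equality case of Jensen's inequality,
  \<open>y\<close> is almost surely constant. The \<open>l i\<close>-marginal can then be expressed through the \<open>l j\<close>-marginal up
  to a constant, so the mass \<open>f P'\<close> of \<open>A\<close> is uncorrelated with itself, and has variance zero.
\<close>

lemma AE_mixing_constant:
  fixes l :: "nat \<Rightarrow> 'a::topological_space \<Rightarrow> real"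
  assumes l: "l \<in> weight_seqs" and P: "P \<in> reweightable_measures l" and \<mu>: "mixing_distribution l \<mu>"
    and ij: "i \<noteq> j"
    and pair: "\<And>B C. B \<in> sets borel \<Longrightarrow> C \<in> sets borel \<Longrightarrow>
      (\<integral>\<^sup>+P'. emeasure (reweight P' (l i)) B * emeasure (reweight P' (l j)) C \<partial>\<mu>) =
      emeasure (reweight P (l i)) B * emeasure (reweight P (l j)) C"
    and A[measurable]: "A \<in> sets borel"
  shows "AE P' in \<mu>. emeasure (reweight P' (l i)) A = emeasure (reweight P (l i)) A"
proof -
  note lm[measurable] = measurable_weight[OF l]
  note int[measurable] = measurable_nn_integral_reweight[OF l \<mu>]
  note em[measurable] = measurable_emeasure_reweight[OF l \<mu>]
  note Zm[measurable] = measurable_nn_integral_mixing[OF \<mu>]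
  note pr = prob_space.emeasure_space_1[OF prob_space_reweight[OF l]]
  have one: "emeasure (reweight P' (l k)) UNIV = 1" if "P' \<in> reweightable_measures l" for P' k
    using pr[OF that, of k] that by simp
  interpret \<mu>: prob_space \<mu> using \<mu> by (simp add: mixing_distribution_def)
  have sp: "P' \<in> reweightable_measures l" if "P' \<in> space \<mu>" for P'
    using that space_mixing[OF \<mu>] by simp
  have ext: "(\<integral>\<^sup>+P'. (\<integral>\<^sup>+x. g x \<partial>reweight P' (l i)) * (\<integral>\<^sup>+x. h x \<partial>reweight P' (l j)) \<partial>\<mu>) =
      (\<integral>\<^sup>+x. g x \<partial>reweight P (l i)) * (\<integral>\<^sup>+x. h x \<partial>reweight P (l j))"
    if g: "g \<in> borel_measurable borel" and h: "h \<in> borel_measurable borel" for g h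
  proof -
    have "(\<integral>\<^sup>+P'. (\<integral>\<^sup>+x. g x \<partial>reweight P' (l i)) * emeasure (reweight P' (l j)) C \<partial>\<mu>) =
        emeasure (reweight P (l j)) C * (\<integral>\<^sup>+x. g x \<partial>reweight P (l i))" if "C \<in> sets borel" for C
      using pair[OF _ that] P
      by (intro nn_integral_mixing_extend[OF l \<mu> em[OF that] _ _ g]) (auto simp: mult.commute)
    then have "(\<integral>\<^sup>+P'. (\<integral>\<^sup>+x. h x \<partial>reweight P' (l j)) * (\<integral>\<^sup>+x. g x \<partial>reweight P' (l i)) \<partial>\<mu>) =
        (\<integral>\<^sup>+x. g x \<partial>reweight P (l i)) * (\<integral>\<^sup>+x. h x \<partial>reweight P (l j))"
      using P by (intro nn_integral_mixing_extend[OF l \<mu> int[OF g] _ _ h]) (auto simp: mult.commute)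
    then show ?thesis by (simp add: mult.commute)
  qed
  let ?Z = "\<lambda>k P'. \<integral>\<^sup>+x. ennreal (l k x) \<partial>P'"
  define y where "y P' = enn2real (?Z i P' / ?Z j P')" for P'
  have y: "?Z i P' / ?Z j P' = ennreal (y P')" "?Z j P' / ?Z i P' = ennreal (1 / y P')" "0 < y P'"
    if "P' \<in> reweightable_measures l" for P'
  proof -
    have Z: "0 < ?Z k P'" "?Z k P' < \<infinity>" for k
      using that by (auto simp: reweightable_measures_def)
    obtain a where a: "?Z i P' = ennreal a" "0 < a" using Z[of i] by (cases "?Z i P'") auto
    obtain b where b: "?Z j P' = ennreal b" "0 < b" using Z[of j] by (cases "?Z j P'") auto
    show "?Z i P' / ?Z j P' = ennreal (y P')" "?Z j P' / ?Z i P' = ennreal (1 / y P')" "0 < y P'"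
      using a b by (simp_all add: y_def divide_ennreal)
  qed
  have ym[measurable]: "y \<in> borel_measurable \<mu>"
    unfolding y_def by measurable
  have ratio: "(\<integral>\<^sup>+x. ennreal (l i x / l j x) * indicator B x \<partial>reweight P' (l j)) =
      emeasure (reweight P' (l i)) B * ennreal (y P')"
    "(\<integral>\<^sup>+x. ennreal (l j x / l i x) * indicator B x \<partial>reweight P' (l i)) =
      emeasure (reweight P' (l j)) B * ennreal (1 / y P')"
    if "P' \<in> reweightable_measures l" "B \<in> sets borel" for P' B
    using nn_integral_reweight_ratio[OF l that] y[OF that(1)] by simp_all
  have ratio1: "(\<integral>\<^sup>+x. ennreal (l i x / l j x) \<partial>reweight P' (l j)) = ennreal (y P')"
    "(\<integral>\<^sup>+x. ennreal (l j x / l i x) \<partial>reweight P' (l i)) = ennreal (1 / y P')"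
    if "P' \<in> reweightable_measures l" for P'
    using ratio[OF that, of UNIV] one[OF that] by simp_all
  define c where "c = y P"
  have c: "0 < c" using y(3)[OF P] by (simp add: c_def)
  have Ey: "(\<integral>\<^sup>+P'. ennreal (y P') \<partial>\<mu>) = ennreal c"
  proof -
    have "(\<integral>\<^sup>+P'. ennreal (y P') \<partial>\<mu>) = (\<integral>\<^sup>+P'. (\<integral>\<^sup>+x. 1 \<partial>reweight P' (l i)) *
        (\<integral>\<^sup>+x. ennreal (l i x / l j x) \<partial>reweight P' (l j)) \<partial>\<mu>)"
      using sp by (intro nn_integral_cong) (simp add: ratio1 pr one)
    also have "\<dots> = ennreal c"
      using P by (subst ext) (simp_all add: ratio1 pr one c_def)
    finally show ?thesis .
  qed
  have Ey': "(\<integral>\<^sup>+P'. ennreal (1 / y P') \<partial>\<mu>) = ennreal (1 / c)"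
  proof -
    have "(\<integral>\<^sup>+P'. ennreal (1 / y P') \<partial>\<mu>) = (\<integral>\<^sup>+P'.
        (\<integral>\<^sup>+x. ennreal (l j x / l i x) \<partial>reweight P' (l i)) * (\<integral>\<^sup>+x. 1 \<partial>reweight P' (l j)) \<partial>\<mu>)"
      using sp by (intro nn_integral_cong) (simp add: ratio1 pr one)
    also have "\<dots> = ennreal (1 / c)"
      using P by (subst ext) (simp_all add: ratio1 pr one c_def)
    finally show ?thesis .
  qed
  \<comment> \<open>\<open>y / c + c / y = 2 + (y - c)\<^sup>2 / (c * y)\<close>, and both sides have expectation 2.\<close>
  have "AE P' in \<mu>. ennreal ((y P' - c)\<^sup>2 / (c * y P')) = 0"
  proof (rule AE_zero_of_nn_integral_add_le[where w = "\<lambda>_. 2"])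
    have "(\<integral>\<^sup>+P'. 2 + ennreal ((y P' - c)\<^sup>2 / (c * y P')) \<partial>\<mu>) =
        (\<integral>\<^sup>+P'. ennreal (1 / c) * ennreal (y P') + ennreal c * ennreal (1 / y P') \<partial>\<mu>)"
    proof (rule nn_integral_cong)
      fix P' assume "P' \<in> space \<mu>"
      then have y0: "0 < y P'" using y(3) sp by blast
      have "2 + ennreal ((y P' - c)\<^sup>2 / (c * y P')) = ennreal (2 + (y P' - c)\<^sup>2 / (c * y P'))"
        using y0 c by (subst ennreal_plus) auto
      also have "2 + (y P' - c)\<^sup>2 / (c * y P') = 1 / c * y P' + c * (1 / y P')"
        using y0 c by (simp add: field_simps power2_eq_square)
      also have "ennreal \<dots> = ennreal (1 / c) * ennreal (y P') + ennreal c * ennreal (1 / y P')"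
        using y0 c by (simp add: ennreal_mult[symmetric] ennreal_plus[symmetric] del: ennreal_plus)
      finally show "2 + ennreal ((y P' - c)\<^sup>2 / (c * y P')) = 
        ennreal (1 / c) * ennreal (y P') + ennreal c * ennreal (1 / y P')" .
    qed
    also have "\<dots> = ennreal (1 / c) * ennreal c + ennreal c * ennreal (1 / c)"
      by (simp add: nn_integral_add nn_integral_cmult Ey Ey')
    also have "\<dots> = 2"
      using c by (simp add: ennreal_mult[symmetric])
    finally show "(\<integral>\<^sup>+P'. 2 + ennreal ((y P' - c)\<^sup>2 / (c * y P')) \<partial>\<mu>) \<le> (\<integral>\<^sup>+P'. 2 \<partial>\<mu>)"
      by (simp add: \<mu>.emeasure_space_1)
  qed (auto simp: \<mu>.emeasure_space_1)
  then have yc: "AE P' in \<mu>. y P' = c"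
  proof (rule AE_mp, intro AE_I2 impI)
    fix P' assume "P' \<in> space \<mu>" and *: "ennreal ((y P' - c)\<^sup>2 / (c * y P')) = 0"
    then have "0 < y P'" using y(3) sp by blast
    then have "0 < c * y P'" using c by simp
    with * show "y P' = c"
      by (auto simp: ennreal_eq_0_iff divide_le_0_iff)
  qed
  define f where "f P' = measure (reweight P' (l i)) A" for P'
  have f: "emeasure (reweight P' (l i)) A = ennreal (f P')" if "P' \<in> reweightable_measures l" for P'
    unfolding f_def using prob_space_reweight[OF l that, of i]
    by (intro finite_measure.emeasure_eq_measure) (rule prob_space.finite_measure)
  have fm[measurable]: "f \<in> borel_measurable \<mu>"
    unfolding f_def measure_def using em[OF A] by measurable
  have f0: "0 \<le> f P'" for P' by (simp add: f_def)
  have Ef: "(\<integral>\<^sup>+P'. ennreal (f P') \<partial>\<mu>) = ennreal (f P)"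
  proof -
    have "(\<integral>\<^sup>+P'. ennreal (f P') \<partial>\<mu>) =
        (\<integral>\<^sup>+P'. emeasure (reweight P' (l i)) A * emeasure (reweight P' (l j)) UNIV \<partial>\<mu>)"
      by (intro nn_integral_cong) (simp add: f sp one)
    then show ?thesis
      using pair[OF A, of UNIV] by (simp add: one P f)
  qed
  have Ef2: "(\<integral>\<^sup>+P'. ennreal (f P') * ennreal (f P') \<partial>\<mu>) = ennreal (f P) * ennreal (f P)"
  proof -
    have "ennreal c * (\<integral>\<^sup>+P'. ennreal (f P') * ennreal (f P') \<partial>\<mu>) =
        (\<integral>\<^sup>+P'. ennreal c * (ennreal (f P') * ennreal (f P')) \<partial>\<mu>)"
      by (intro nn_integral_cmult[symmetric]) measurable
    also have "\<dots> = (\<integral>\<^sup>+P'. (\<integral>\<^sup>+x. indicator A x \<partial>reweight P' (l i)) *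
        (\<integral>\<^sup>+x. ennreal (l i x / l j x) * indicator A x \<partial>reweight P' (l j)) \<partial>\<mu>)"
    proof (rule nn_integral_cong_AE, rule AE_mp[OF yc], intro AE_I2 impI)
      fix P' assume P': "P' \<in> space \<mu>" and "y P' = c"
      then show "ennreal c * (ennreal (f P') * ennreal (f P')) =
        (\<integral>\<^sup>+x. indicator A x \<partial>reweight P' (l i)) *
        (\<integral>\<^sup>+x. ennreal (l i x / l j x) * indicator A x \<partial>reweight P' (l j))"
        unfolding ratio(1)[OF sp[OF P'] A] using sp[OF P'] by (simp add: f mult_ac)
    qed
    also have "\<dots> = (\<integral>\<^sup>+x. indicator A x \<partial>reweight P (l i)) *
        (\<integral>\<^sup>+x. ennreal (l i x / l j x) * indicator A x \<partial>reweight P (l j))"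
      by (rule ext) measurable
    also have "\<dots> = ennreal c * (ennreal (f P) * ennreal (f P))"
      unfolding ratio(1)[OF P A] using P by (simp add: f c_def mult_ac)
    finally show ?thesis
      using c by (simp add: ennreal_mult_cancel_left)
  qed
  have "AE P' in \<mu>. ennreal ((f P' - f P)\<^sup>2) = 0"
  proof (rule AE_zero_of_nn_integral_add_le[where w = "\<lambda>P'. 2 * (ennreal (f P) * ennreal (f P'))"])
    have "(\<integral>\<^sup>+P'. 2 * (ennreal (f P) * ennreal (f P')) + ennreal ((f P' - f P)\<^sup>2) \<partial>\<mu>) =
        (\<integral>\<^sup>+P'. ennreal (f P') * ennreal (f P') + ennreal (f P) * ennreal (f P) \<partial>\<mu>)"
    proof (rule nn_integral_cong)
      fix P'
      have "2 * (ennreal (f P) * ennreal (f P')) + ennreal ((f P' - f P)\<^sup>2) =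
          ennreal (2 * (f P * f P') + (f P' - f P)\<^sup>2)"
        using f0 by (simp add: ennreal_mult ennreal_plus)
      also have "2 * (f P * f P') + (f P' - f P)\<^sup>2 = f P' * f P' + f P * f P"
        by (simp add: power2_eq_square algebra_simps)
      also have "ennreal \<dots> = ennreal (f P') * ennreal (f P') + ennreal (f P) * ennreal (f P)"
        using f0 by (simp add: ennreal_mult ennreal_plus)
      finally show "2 * (ennreal (f P) * ennreal (f P')) + ennreal ((f P' - f P)\<^sup>2) =
          ennreal (f P') * ennreal (f P') + ennreal (f P) * ennreal (f P)" .
    qed
    also have "\<dots> = 2 * (ennreal (f P) * ennreal (f P))"
      by (simp add: nn_integral_add Ef2 \<mu>.emeasure_space_1 mult_2)
    also have "\<dots> = (\<integral>\<^sup>+P'. 2 * (ennreal (f P) * ennreal (f P')) \<partial>\<mu>)"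
      by (simp add: nn_integral_cmult Ef)
    finally show "(\<integral>\<^sup>+P'. 2 * (ennreal (f P) * ennreal (f P')) + ennreal ((f P' - f P)\<^sup>2) \<partial>\<mu>) \<le>
        (\<integral>\<^sup>+P'. 2 * (ennreal (f P) * ennreal (f P')) \<partial>\<mu>)" by simp
  qed (auto simp: nn_integral_cmult Ef ennreal_mult_eq_top_iff)
  then show ?thesis
  proof (rule AE_mp, intro AE_I2 impI)
    fix P' assume "P' \<in> space \<mu>" "ennreal ((f P' - f P)\<^sup>2) = 0"
    then show "emeasure (reweight P' (l i)) A = emeasure (reweight P (l i)) A"
      by (simp add: f sp P ennreal_eq_0_iff)
  qed
qed

section \<open>From the de Finetti property to the zero-one law\<close>

lemma weights_dF_subset_01:
  "(weights_dF :: (nat \<Rightarrow> 'a::topological_space \<Rightarrow> real) set) \<subseteq> weights_01"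
proof
  fix l :: "nat \<Rightarrow> 'a \<Rightarrow> real" assume dF: "l \<in> weights_dF"
  then have l: "l \<in> weight_seqs" by (simp add: weights_dF_def)
  show "l \<in> weights_01"
    unfolding weights_01_def
  proof (intro CollectI conjI ballI l, rule ccontr)
    fix P and A :: "(nat \<Rightarrow> 'a) set"
    assume P: "P \<in> reweightable_measures l" and A: "A \<in> exchangeable_algebra"
      and "emeasure (reweight_seq P l) A \<notin> {0, 1}"
    let ?R = "reweight_seq P l"
    interpret prob_space ?R by (rule prob_space_reweight_seq[OF l P])
    have Am[measurable]: "A \<in> sets ?R"
      using A P by (simp add: exchangeable_algebra_def)
    define p where "p = prob A"
    have p: "0 < p" "p < 1"
      using \<open>emeasure ?R A \<notin> {0, 1}\<close> prob_le_1[of A] measure_nonneg[of ?R A]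
      by (auto simp: emeasure_eq_measure p_def less_le)
    \<comment> \<open>Both conditional laws, given \<open>A\<close> and given its complement, are mixtures; \<open>E b\<close> is the conditioning
      event and \<open>w b\<close> its probability.\<close>
    define E where "E b = (if b then A else - A)" for b
    define w where "w b = (if b then p else 1 - p)" for b
    have E: "E b \<in> exchangeable_algebra" for b
      using A exchangeable_algebra_Compl[OF A] by (simp add: E_def)
    have Em[measurable]: "E b \<in> sets ?R" for b
      using E[of b] P by (simp add: exchangeable_algebra_def)
    have emE: "emeasure ?R (E b) = ennreal (w b)" and w: "0 < w b" for b
      using p prob_compl[OF Am] P
      by (auto simp: E_def w_def emeasure_eq_measure p_def Compl_eq_Diff_UNIV)
    have "\<exists>\<mu>. mixing_distribution l \<mu> \<and> uniform_measure ?R (E b) = mixture l \<mu>" for b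
    proof -
      have "prob_space (uniform_measure ?R (E b))"
        using w[of b] by (intro prob_space_uniform_measure) (auto simp: emE)
      moreover have "weighted_exchangeable l (uniform_measure ?R (E b))"
        by (rule weighted_exchangeable_uniform[OF l P E])
      ultimately show ?thesis using dF unfolding weights_dF_def by blast
    qed
    then obtain N where N: "\<And>b. mixing_distribution l (N b)"
      and NQ: "\<And>b. uniform_measure ?R (E b) = mixture l (N b)" by metis
    have Npr: "prob_space (N b)" and sN: "sets (N b) = sets (N True)" for b
      using N[of b] N[of True] by (simp_all add: mixing_distribution_def)
    have rect: "(\<integral>\<^sup>+P'. (\<Prod>i\<in>J. emeasure (reweight P' (l i)) (B i)) \<partial>N b) =
        emeasure ?R (E b \<inter> {x. \<forall>i\<in>J. x i \<in> B i}) / ennreal (w b)"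
      if J: "finite J" and B: "\<And>i. i \<in> J \<Longrightarrow> B i \<in> sets borel" for J B b
    proof -
      have "prob_space (mixture l (N b))"
        unfolding NQ[symmetric] using w[of b] by (intro prob_space_uniform_measure) (auto simp: emE)
      from emeasure_mixture_rectangle[OF l N this J B]
      have "(\<integral>\<^sup>+P'. (\<Prod>i\<in>J. emeasure (reweight P' (l i)) (B i)) \<partial>N b) =
          emeasure (uniform_measure ?R (E b)) {x. \<forall>i\<in>J. x i \<in> B i}"
        unfolding NQ by simp
      then show ?thesis
        using rectangle_in_sets[of J B, OF J B] P Em by (simp add: emE)
    qed
    \<comment> \<open>By the law of total probability, the unconditional product law is the mixture over \<open>\<mu>\<close>.\<close>
    define \<mu> where "\<mu> = measure_pmf (bernoulli_pmf p) \<bind> N"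
    have Nm: "N \<in> measurable (measure_pmf (bernoulli_pmf p)) (subprob_algebra (N True))"
      using Npr sN by (auto simp: space_subprob_algebra prob_space_imp_subprob_space measurable_def)
    have s\<mu>: "sets \<mu> = sets (N True)"
      unfolding \<mu>_def using sN by (intro sets_bind) auto
    have "prob_space \<mu>"
      unfolding \<mu>_def
      using Npr by (intro measure_pmf.prob_space_bind[OF _ Nm]) auto
    then have \<mu>: "mixing_distribution l \<mu>"
      using N[of True] by (simp add: mixing_distribution_def s\<mu>)
    have int\<mu>: "(\<integral>\<^sup>+P'. f P' \<partial>\<mu>) = (\<integral>\<^sup>+P'. f P' \<partial>N True) * ennreal p + (\<integral>\<^sup>+P'. f P' \<partial>N False) * ennreal (1 - p)"
      if "f \<in> borel_measurable (N True)" for f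
      unfolding \<mu>_def using p by (subst nn_integral_bind[OF that Nm]) simp
    have pair: "(\<integral>\<^sup>+P'. emeasure (reweight P' (l i)) B * emeasure (reweight P' (l j)) C \<partial>\<mu>) =
        emeasure (reweight P (l i)) B * emeasure (reweight P (l j)) C"
      if "i \<noteq> j" and B: "B \<in> sets borel" and C: "C \<in> sets borel" for i j B C
    proof -
      let ?B = "\<lambda>k. if k = i then B else C"
      let ?S = "{x. \<forall>k\<in>{i, j}. x k \<in> ?B k}"
      have BC: "?B k \<in> sets borel" for k using B C by simp
      have S: "?S \<in> sets ?R" using rectangle_in_sets[of "{i, j}" ?B] BC P by simp
      have pr: "(\<Prod>k\<in>{i, j}. emeasure (reweight P' (l k)) (?B k)) =
          emeasure (reweight P' (l i)) B * emeasure (reweight P' (l j)) C" for P'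
        using \<open>i \<noteq> j\<close> by auto
      have "(\<integral>\<^sup>+P'. emeasure (reweight P' (l i)) B * emeasure (reweight P' (l j)) C \<partial>\<mu>) =
          (\<integral>\<^sup>+P'. emeasure (reweight P' (l i)) B * emeasure (reweight P' (l j)) C \<partial>N True) * ennreal p +
          (\<integral>\<^sup>+P'. emeasure (reweight P' (l i)) B * emeasure (reweight P' (l j)) C \<partial>N False) * ennreal (1 - p)"
        by (intro int\<mu> borel_measurable_times_ennreal measurable_emeasure_reweight[OF l N] B C)
      also have "\<dots> = emeasure ?R (A \<inter> ?S) / ennreal p * ennreal p +
          emeasure ?R (- A \<inter> ?S) / ennreal (1 - p) * ennreal (1 - p)"
        using rect[of "{i, j}" ?B True] rect[of "{i, j}" ?B False] BC
        unfolding pr by (simp add: E_def w_def)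
      also have "\<dots> = emeasure ?R (A \<inter> ?S) + emeasure ?R (- A \<inter> ?S)"
      proof -
        have "a / ennreal r * ennreal r = a" if "0 < r" for a r
          using that by (metis ennreal_divide_times ennreal_mult_divide_eq ennreal_neq_top
              ennreal_eq_0_iff not_less mult.commute ennreal_times_divide)
        then show ?thesis using p by simp
      qed
      also have "\<dots> = emeasure ?R ((A \<inter> ?S) \<union> (- A \<inter> ?S))"
        using Em[of True] Em[of False] S by (intro plus_emeasure) (auto simp: E_def)
      also have "(A \<inter> ?S) \<union> (- A \<inter> ?S) = ?S" by blast
      also have "emeasure ?R ?S = emeasure (reweight P (l i)) B * emeasure (reweight P (l j)) C"
        using BC by (subst emeasure_reweight_seq_rectangle[OF l P]) (simp_all add: pr del: prod.insert)
      finally show ?thesis .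
    qed
    have const: "AE P' in N True. emeasure (reweight P' (l i)) B = emeasure (reweight P (l i)) B"
      if B: "B \<in> sets borel" for i B
    proof -
      have "AE P' in \<mu>. emeasure (reweight P' (l i)) B = emeasure (reweight P (l i)) B"
        by (rule AE_mixing_constant[OF l P \<mu> n_not_Suc_n pair[OF n_not_Suc_n] B])
      moreover have "Measurable.pred (N True)
          (\<lambda>P'. emeasure (reweight P' (l i)) B = emeasure (reweight P (l i)) B)"
        using measurable_emeasure_reweight[OF l N B, of i True] by measurable
      ultimately have "AE b in measure_pmf (bernoulli_pmf p). AE P' in N b.
          emeasure (reweight P' (l i)) B = emeasure (reweight P (l i)) B"
        unfolding \<mu>_def by (subst (asm) AE_bind[OF Nm])
      then show ?thesis using p by (simp add: AE_measure_pmf_iff)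
    qed
    \<comment> \<open>Hence conditioning on \<open>A\<close> does not change the law, so that \<open>A\<close> has probability 1.\<close>
    have "uniform_measure ?R A = ?R"
    proof (rule reweight_seq_eqI[OF l P])
      show "sets (uniform_measure ?R A) = sets seq_space" using P by simp
      fix J and B :: "nat \<Rightarrow> 'a set"
      assume J: "finite J" and B: "\<And>i. i \<in> J \<Longrightarrow> B i \<in> sets (borel :: 'a measure)"
      have "AE P' in N True. \<forall>i\<in>J. emeasure (reweight P' (l i)) (B i) = emeasure (reweight P (l i)) (B i)"
        using J const[OF B] by (intro AE_finite_allI) auto
      then have "(\<integral>\<^sup>+P'. (\<Prod>i\<in>J. emeasure (reweight P' (l i)) (B i)) \<partial>N True) =
          (\<integral>\<^sup>+P'. (\<Prod>i\<in>J. emeasure (reweight P (l i)) (B i)) \<partial>N True)"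
        by (intro nn_integral_cong_AE) (auto elim: eventually_mono)
      also have "\<dots> = (\<Prod>i\<in>J. emeasure (reweight P (l i)) (B i))"
        using prob_space.emeasure_space_1[OF Npr] by simp
      finally show "emeasure (uniform_measure ?R A) {x. \<forall>i\<in>J. x i \<in> B i} =
          (\<Prod>i\<in>J. emeasure (reweight P (l i)) (B i))"
        using rect[of J B True, OF J B] rectangle_in_sets[of J B, OF J B] P Am emE[of True]
        by (simp add: E_def)
    qed
    moreover have "emeasure (uniform_measure ?R A) A = 1"
      using emE[of True] w[of True] by (intro emeasure_uniform_measure_1) (auto simp: E_def)
    ultimately show False
      using \<open>emeasure ?R A \<notin> {0, 1}\<close> by simp
  qed
qed

theorem theorem4:
  shows "(weights_dF :: (nat \<Rightarrow> 'a::polish_space \<Rightarrow> real) set) \<subseteq> weights_01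
    \<and> (weights_01 :: (nat \<Rightarrow> 'a \<Rightarrow> real) set) \<subseteq> weights_LLN"
  using weights_dF_subset_01 weights_01_subset_LLN by blast


end
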